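(* Let $n\ge1$. The map $\mathrm{ruffle}:\mathrm{Ruffle}_n\to S_n$ does the right thing with respect to $\mathrm{hand}$ on $\mathrm{Ruffle}_n$ and the turning number on $S_n$; moreover the projection $\pi:\bar S_n\to S_n$ that forgets orientations does the right thing with respect to the oriented rising number on $\bar S_n$ and the turning number on $S_n$. Consequently the turning number is a lumping of $S_n$: the sums $\sum_\sigma\sigma$ over all $\sigma\in S_n$ with a given number of turning points form a basis of a subalgebra of the group algebra $\mathbf{Q}[S_n]$ (the turning algebra), and this subalgebra is commutative.
   Context: Permutations are composed left to right: $(\sigma\tau)(i)=\tau(\sigma(i))$. $S_n$ is the symmetric group on $\{1,\dots,n\}$; $\sigma(i)$ is the position to which the card originally in position $i$ is moved. $\bar S_n$ is the group of oriented (signed) permutations: bijections $w$ of $\{\pm1,\dots,\pm n\}$ with $w(-i)=-w(i)$, also composed left to right; the card in position $i$ is moved to position $|w(i)|$ and is turned over iff $w(i)<0$. The projection is $\pi(w)(i)=|w(i)|$. A permutation $\sigma\in S_n$ has a turning point at $i$, $1\le i<n$, if, setting $\sigma(0)=0$ and interpolating linearly to a piecewise linear map on $[0,n]$, the graph has a local maximum or minimum at $i$; i.e. $\sigma(i)-\sigma(i-1)$ and $\sigma(i+1)-\sigma(i)$ have opposite signs. (So $1$ is a turning point iff $\sigma(2)<\sigma(1)$, and $n$ is never one.) The turning number of $\sigma$ is its number of turning points. The ruffle monoid $\mathrm{Ruffle}_n$ has as elements the pairs $(a,x)$, with $a\ge1$ an integer and $x=(x_1,\dots,x_n)$ integers,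 $0\le x_i<a$. Each $(a,x)$ describes an $a$-handed ruffle: let $c_j=\#\{i:x_i=j\}$; hand $j$ ($0\le j<a$) receives the cards $c_0+\dots+c_{j-1}+1,\dots,c_0+\dots+c_j$; the odd-numbered hands are turned over as a bunch (order reversed, each card's orientation flipped); then the hands are interleaved so that the card in final position $i$ comes from hand $x_i$. Thus, in the positions $i$ with $x_i=j$, read in increasing order, the cards of hand $j$ appear in increasing order and unflipped if $j$ is even, and in decreasing order and flipped if $j$ is odd. The resulting oriented permutation is $\mathrm{orientedruffle}(a,x)\in\bar S_n$, and $\mathrm{ruffle}(a,x)=\pi(\mathrm{orientedruffle}(a,x))\in S_n$. $S_n$ acts on lists by $(x^\sigma)_{\sigma(i)}=x_i$. The product in $\mathrm{Ruffle}_n$ is $(a,x)*(b,y)=(ab,z)$, where, with $x'=x^{\mathrm{ruffle}(b,y)}$, $z_i=bx'_i+y_i$ if $x'_i$ is even and $z_i=bx'_i+b-1-y_i$ if $x'_i$ is odd. The function $\mathrm{hand}$ on $\mathrm{Ruffle}_n$ is $\mathrm{hand}(a,x)=a$. The oriented rising number of $w\in\bar S_n$ is the minimum $a$ such that $w=\mathrm{orientedruffle}(a,x)$ for some $x$. A function $\mu$ on a monoid $M$ is a lumping if its equivalence classes (level sets) are finite and the class sums form a basis of a subalgebra of $\mathbf{Q}[M]$ (a linear subspace closed under multiplication). Given a lumping $\mu$ of $M$ and a function $\nu$ with finite level sets on a monoid $N$, a monoid homomorphism $f:M\to N$ does the right thing with respect to $\mu$ and $\nu$ if the elements $\sum_{x\in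 C}f(x)$, $C$ ranging over the $\mu$-classes, belong to and span the subspace of $\mathbf{Q}[N]$ spanned by the class sums of $\nu$. The function $\mathrm{hand}$ is a lumping of $\mathrm{Ruffle}_n$, and the oriented rising number is a lumping of $\bar S_n$. *)

theory Defs
  imports Complex_Main "HOL-Algebra.Group" "HOL-Library.FuncSet" "HOL-Library.Poly_Mapping"
    "HOL-Combinatorics.Permutations"
begin

section \<open>Rational monoid algebras\<close>

text \<open>
  The algebra \<open>\<rat>[M]\<close> consists of the finitely supported functions into \<^typ>\<open>rat\<close> whose support
  lies in the carrier of \<open>M\<close>. The product built into \<^typ>\<open>'a \<Rightarrow>\<^sub>0 rat\<close> belongs to additive type
  classes, so the convolution for \<open>M\<close> is defined separately.
\<close>

definition malg_carrier :: "('a, 'm) monoid_scheme \<Rightarrow> ('a \<Rightarrow>\<^sub>0 rat) set"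
  where "malg_carrier M = {f. Poly_Mapping.keys f \<subseteq> carrier M}"

definition malg_mult :: "('a, 'm) monoid_scheme \<Rightarrow> ('a \<Rightarrow>\<^sub>0 rat) \<Rightarrow> ('a \<Rightarrow>\<^sub>0 rat) \<Rightarrow> ('a \<Rightarrow>\<^sub>0 rat)"
  where "malg_mult M f g =
    (\<Sum>x\<in>Poly_Mapping.keys f. \<Sum>y\<in>Poly_Mapping.keys g. Poly_Mapping.single (x \<otimes>\<^bsub>M\<^esub> y) (Poly_Mapping.lookup f x * Poly_Mapping.lookup g y))"

definition malg_scale :: "rat \<Rightarrow> ('a \<Rightarrow>\<^sub>0 rat) \<Rightarrow> ('a \<Rightarrow>\<^sub>0 rat)"
  where "malg_scale c f = Poly_Mapping.map (\<lambda>v. c * v) f"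

lemma lookup_malg_scale [simp]: "Poly_Mapping.lookup (malg_scale c f) x = c * Poly_Mapping.lookup f x"
  by (simp add: malg_scale_def map.rep_eq when_def)

global_interpretation malg: vector_space "malg_scale :: rat \<Rightarrow> ('a \<Rightarrow>\<^sub>0 rat) \<Rightarrow> ('a \<Rightarrow>\<^sub>0 rat)"
  by unfold_locales (simp_all add: poly_mapping_eq_iff fun_eq_iff lookup_add algebra_simps)

text \<open>As in the source, subalgebras are not required to contain the unit.\<close>

definition malg_subalgebra :: "('a, 'm) monoid_scheme \<Rightarrow> ('a \<Rightarrow>\<^sub>0 rat) set \<Rightarrow> bool"
  where "malg_subalgebra M A \<longleftrightarrow>
    A \<subseteq> malg_carrier M \<and> malg.subspace A \<and> (\<forall>f\<in>A. \<forall>g\<in>A. malg_mult M f g \<in> A)"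

definition is_basis :: "('a \<Rightarrow>\<^sub>0 rat) set \<Rightarrow> ('a \<Rightarrow>\<^sub>0 rat) set \<Rightarrow> bool"
  where "is_basis B A \<longleftrightarrow> malg.independent B \<and> malg.span B = A"


section \<open>Lumpings\<close>

definition level_sets :: "('a, 'm) monoid_scheme \<Rightarrow> ('a \<Rightarrow> 'k) \<Rightarrow> 'a set set"
  where "level_sets M \<mu> = {{x \<in> carrier M. \<mu> x = \<mu> y} | y. y \<in> carrier M}"

definition class_sum :: "'a set \<Rightarrow> ('a \<Rightarrow>\<^sub>0 rat)"
  where "class_sum C = (\<Sum>x\<in>C. Poly_Mapping.single x 1)"

definition class_sums :: "('a, 'm) monoid_scheme \<Rightarrow> ('a \<Rightarrow> 'k) \<Rightarrow> ('a \<Rightarrow>\<^sub>0 rat) set"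
  where "class_sums M \<mu> = class_sum ` level_sets M \<mu>"

definition lumping :: "('a, 'm) monoid_scheme \<Rightarrow> ('a \<Rightarrow> 'k) \<Rightarrow> bool"
  where "lumping M \<mu> \<longleftrightarrow> monoid M \<and> (\<forall>C\<in>level_sets M \<mu>. finite C) \<and>
    (\<exists>A. malg_subalgebra M A \<and> is_basis (class_sums M \<mu>) A)"

definition monoid_hom :: "('a, 'm) monoid_scheme \<Rightarrow> ('b, 'n) monoid_scheme \<Rightarrow> ('a \<Rightarrow> 'b) \<Rightarrow> bool"
  where "monoid_hom M N f \<longleftrightarrow> monoid M \<and> monoid N \<and> f \<in> hom M N \<and> f \<one>\<^bsub>M\<^esub> = \<one>\<^bsub>N\<^esub>"

definition image_class_sums ::
    "('a, 'm) monoid_scheme \<Rightarrow> ('a \<Rightarrow> 'k) \<Rightarrow> ('a \<Rightarrow> 'b) \<Rightarrow> ('b \<Rightarrow>\<^sub>0 rat) set"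
  where "image_class_sums M \<mu> f = (\<lambda>C. \<Sum>x\<in>C. Poly_Mapping.single (f x) 1) ` level_sets M \<mu>"

text \<open>The presuppositions on \<open>\<mu>\<close>, \<open>\<nu>\<close> and \<open>f\<close> are part of the definition.\<close>

definition does_the_right_thing ::
    "('a, 'm) monoid_scheme \<Rightarrow> ('a \<Rightarrow> 'k) \<Rightarrow> ('b, 'n) monoid_scheme \<Rightarrow> ('b \<Rightarrow> 'l) \<Rightarrow> ('a \<Rightarrow> 'b) \<Rightarrow> bool"
  where "does_the_right_thing M \<mu> N \<nu> f \<longleftrightarrow>
    lumping M \<mu> \<and> (\<forall>D\<in>level_sets N \<nu>. finite D) \<and> monoid_hom M N f \<and>
    image_class_sums M \<mu> f \<subseteq> malg.span (class_sums N \<nu>) \<and>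
    malg.span (image_class_sums M \<mu> f) = malg.span (class_sums N \<nu>)"


section \<open>Permutations and signed permutations\<close>

text \<open>Products are taken from left to right, opposite to \<^term>\<open>(\<circ>)\<close>.\<close>

definition symmetric_group :: "nat \<Rightarrow> (nat \<Rightarrow> nat) monoid"
  where "symmetric_group n =
    \<lparr>carrier = {\<sigma>. \<sigma> permutes {1..n}}, monoid.mult = (\<lambda>\<sigma> \<tau>. \<tau> \<circ> \<sigma>), one = id\<rparr>"

definition oriented_group :: "nat \<Rightarrow> (int \<Rightarrow> int) monoid"
  where "oriented_group n =
    \<lparr>carrier = {w. w permutes {i. 1 \<le> \<bar>i\<bar> \<and> \<bar>i\<bar> \<le> int n} \<and> (\<forall>i. w (- i) = - w i)},
     monoid.mult = (\<lambda>v w. w \<circ> v), one = id\<rparr>"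

definition forget_orientation :: "(int \<Rightarrow> int) \<Rightarrow> (nat \<Rightarrow> nat)"
  where "forget_orientation w = (\<lambda>i. nat \<bar>w (int i)\<bar>)"

text \<open>A permutation of \<open>{1..n}\<close> satisfies \<open>\<sigma> 0 = 0\<close>, as the convention at \<open>i = 1\<close> requires.\<close>

definition turning_point :: "nat \<Rightarrow> (nat \<Rightarrow> nat) \<Rightarrow> nat \<Rightarrow> bool"
  where "turning_point n \<sigma> i \<longleftrightarrow> 1 \<le> i \<and> i < n \<and>
    (\<sigma> (i - 1) < \<sigma> i \<and> \<sigma> (i + 1) < \<sigma> i \<or> \<sigma> i < \<sigma> (i - 1) \<and> \<sigma> i < \<sigma> (i + 1))"

definition turning_number :: "nat \<Rightarrow> (nat \<Rightarrow> nat) \<Rightarrow> nat"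
  where "turning_number n \<sigma> = card {i. turning_point n \<sigma> i}"


section \<open>Ruffles\<close>

definition hand_size :: "nat \<Rightarrow> (nat \<Rightarrow> nat) \<Rightarrow> nat \<Rightarrow> nat"
  where "hand_size n x j = card {i \<in> {1..n}. x i = j}"

text \<open>
  The card that ends up in position \<open>i\<close>, for \<open>1 \<le> i \<le> n\<close>, given by its original position and
  negated if it has been turned over. Position \<open>i\<close> is the \<open>r\<close>-th one fed by hand \<open>j\<close>, and that
  hand consists of the cards \<open>s + 1, \<dots>, s + c\<close>, in reverse order if \<open>j\<close> is odd.
\<close>

definition dealt_card :: "nat \<Rightarrow> (nat \<Rightarrow> nat) \<Rightarrow> nat \<Rightarrow> int"
  where "dealt_card n x i =
    (let j = x i; s = (\<Sum>k<j. hand_size n x k); c = hand_size n x j;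
         r = card {i' \<in> {1..i}. x i' = j}
     in if even j then int (s + r) else - int (s + c + 1 - r))"

text \<open>
  The odd extension of \<^const>\<open>dealt_card\<close> sends final to original positions; an oriented ruffle
  sends original to final positions, hence the inverse.
\<close>

definition oriented_origin :: "nat \<Rightarrow> (nat \<Rightarrow> nat) \<Rightarrow> int \<Rightarrow> int"
  where "oriented_origin n x i =
    (if 1 \<le> \<bar>i\<bar> \<and> \<bar>i\<bar> \<le> int n then sgn i * dealt_card n x (nat \<bar>i\<bar>) else i)"

definition orientedruffle :: "nat \<Rightarrow> nat \<times> (nat \<Rightarrow> nat) \<Rightarrow> (int \<Rightarrow> int)"
  where "orientedruffle n = (\<lambda>(a, x). inv_into UNIV (oriented_origin n x))"

definition ruffle :: "nat \<Rightarrow> nat \<times> (nat \<Rightarrow> nat) \<Rightarrow> (nat \<Rightarrow> nat)"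
  where "ruffle n p = forget_orientation (orientedruffle n p)"

text \<open>The action \<open>x\<^sup>\<sigma>\<close>, determined by \<open>x\<^sup>\<sigma> (\<sigma> i) = x i\<close>.\<close>

definition act :: "(nat \<Rightarrow> nat) \<Rightarrow> (nat \<Rightarrow> nat) \<Rightarrow> (nat \<Rightarrow> nat)"
  where "act x \<sigma> = x \<circ> inv_into UNIV \<sigma>"

definition ruffle_mult ::
    "nat \<Rightarrow> nat \<times> (nat \<Rightarrow> nat) \<Rightarrow> nat \<times> (nat \<Rightarrow> nat) \<Rightarrow> nat \<times> (nat \<Rightarrow> nat)"
  where "ruffle_mult n = (\<lambda>(a, x) (b, y).
    let x' = act x (ruffle n (b, y))
    in (a * b, \<lambda>i\<in>{1..n}. if even (x' i) then b * x' i + y i else b * x' i + b - 1 - y i))"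

definition ruffle_monoid :: "nat \<Rightarrow> (nat \<times> (nat \<Rightarrow> nat)) monoid"
  where "ruffle_monoid n =
    \<lparr>carrier = {(a, x). 1 \<le> a \<and> x \<in> {1..n} \<rightarrow>\<^sub>E {..<a}},
     monoid.mult = ruffle_mult n, one = (1, \<lambda>i\<in>{1..n}. 0)\<rparr>"

definition hand :: "nat \<times> (nat \<Rightarrow> nat) \<Rightarrow> nat"
  where "hand = fst"

definition oriented_rising_number :: "nat \<Rightarrow> (int \<Rightarrow> int) \<Rightarrow> nat"
  where "oriented_rising_number n w =
    (LEAST a. \<exists>x. (a, x) \<in> carrier (ruffle_monoid n) \<and> w = orientedruffle n (a, x))"

definition turning_algebra :: "nat \<Rightarrow> ((nat \<Rightarrow> nat) \<Rightarrow>\<^sub>0 rat) set"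
  where "turning_algebra n = malg.span (class_sums (symmetric_group n) (turning_number n))"

end

theory Submission
  imports Defs
begin

text \<open>
  An oriented permutation \<open>w\<close> is the oriented ruffle given by \<open>x\<close> iff the hands \<open>y k = x \<bar>w k\<bar>\<close> of
  the cards \<open>k = 1, \<dots>, n\<close> increase weakly, strictly where \<open>w\<close> descends, with \<open>y k\<close> odd iff
  \<open>w k < 0\<close>. This criterion shows that ruffling is a homomorphism. Since the products of the
  \<open>a\<close>-handed and the \<open>b\<close>-handed ruffles run exactly once through the \<open>a b\<close>-handed ones, the images
  of the hand classes multiply like the numbers \<open>a\<close>; their span is a commutative algebra.

  It also gives a least sequence \<open>m\<close> of hands for each \<open>w\<close>, and all others are \<open>m + 2 e\<close> with \<open>e\<close>
  weakly increasing. So \<open>m n + 1\<close> is the oriented rising number, and the number of \<open>a\<close>-handed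
  ruffles giving \<open>w\<close> depends only on \<open>a\<close> and this number, triangularly. Over a permutation with \<open>t\<close>
  turning points, an orientation contributes to \<open>m n\<close> the amount 1 at every turning point, 0 or 2 at
  every other \<open>k < n\<close> and 0 or 1 at \<open>n\<close>. Hence the orientations with given \<open>m n\<close> are counted by \<open>t\<close>
  alone; there are \<open>2\<^sup>t\<close> for the least value \<open>m n = t\<close>, so the counts are triangular again.
\<close>

section \<open>Class sums in monoid algebras\<close>

text \<open>Enlarging the index sets beyond the supports only adds terms with coefficient
  \<open>0\<close>. This lets elements with different supports be summed over common sets, from
  which bilinearity follows.\<close>

lemma malg_mult_eq:
  assumes "finite A" "finite B" "Poly_Mapping.keys f \<subseteq> A" "Poly_Mapping.keys g \<subseteq> B"
  shows "malg_mult M f g =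
    (\<Sum>x\<in>A. \<Sum>y\<in>B. Poly_Mapping.single (x \<otimes>\<^bsub>M\<^esub> y) (Poly_Mapping.lookup f x * Poly_Mapping.lookup g y))"
proof -
  have "(\<Sum>y\<in>B. Poly_Mapping.single (x \<otimes>\<^bsub>M\<^esub> y) (Poly_Mapping.lookup f x * Poly_Mapping.lookup g y)) =
      (\<Sum>y\<in>Poly_Mapping.keys g.
         Poly_Mapping.single (x \<otimes>\<^bsub>M\<^esub> y) (Poly_Mapping.lookup f x * Poly_Mapping.lookup g y))" for x
    using assms by (intro sum.mono_neutral_right) (auto simp: in_keys_iff)
  then show ?thesis
    unfolding malg_mult_def using assms
    by (simp only:) (intro sum.mono_neutral_left, auto simp: in_keys_iff)
qed

lemma malg_mult_add_left: "malg_mult M (f + g) h = malg_mult M f h + malg_mult M g h"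
proof -
  let ?A = "Poly_Mapping.keys f \<union> Poly_Mapping.keys g" and ?B = "Poly_Mapping.keys h"
  have "Poly_Mapping.keys (f + g) \<subseteq> ?A"
    by (rule Poly_Mapping.keys_add)
  then show ?thesis
    by (simp add: malg_mult_eq[of ?A ?B] lookup_add algebra_simps single_add sum.distrib)
qed

lemma malg_mult_add_right: "malg_mult M h (f + g) = malg_mult M h f + malg_mult M h g"
proof -
  let ?A = "Poly_Mapping.keys f \<union> Poly_Mapping.keys g" and ?B = "Poly_Mapping.keys h"
  have "Poly_Mapping.keys (f + g) \<subseteq> ?A"
    by (rule Poly_Mapping.keys_add)
  then show ?thesis
    by (simp add: malg_mult_eq[of ?B ?A] lookup_add algebra_simps single_add sum.distrib)
qed

lemma malg_scale_sum: "malg_scale c (sum f A) = (\<Sum>x\<in>A. malg_scale c (f x))"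
  by (rule malg.scale_sum_right)

lemma malg_scale_single: "malg_scale c (Poly_Mapping.single x v) = Poly_Mapping.single x (c * v)"
  by (rule poly_mapping_eqI) (simp add: lookup_single when_def)

lemma keys_malg_scale: "Poly_Mapping.keys (malg_scale c f) \<subseteq> Poly_Mapping.keys f"
  by (auto simp: in_keys_iff)

lemma malg_mult_scale_left: "malg_mult M (malg_scale c f) g = malg_scale c (malg_mult M f g)"
  by (simp add: malg_mult_eq[of "Poly_Mapping.keys f" "Poly_Mapping.keys g"] keys_malg_scale
      malg_scale_sum malg_scale_single algebra_simps)

lemma malg_mult_scale_right: "malg_mult M f (malg_scale c g) = malg_scale c (malg_mult M f g)"
  by (simp add: malg_mult_eq[of "Poly_Mapping.keys f" "Poly_Mapping.keys g"] keys_malg_scale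
      malg_scale_sum malg_scale_single algebra_simps)

lemma malg_mult_zero [simp]: "malg_mult M 0 f = 0" "malg_mult M f 0 = 0"
  by (simp_all add: malg_mult_def)

lemma malg_mult_sum_left: "malg_mult M (sum f A) g = (\<Sum>x\<in>A. malg_mult M (f x) g)"
  by (induction A rule: infinite_finite_induct) (simp_all add: malg_mult_add_left)

lemma malg_mult_sum_right: "malg_mult M g (sum f A) = (\<Sum>x\<in>A. malg_mult M g (f x))"
  by (induction A rule: infinite_finite_induct) (simp_all add: malg_mult_add_right)

lemma malg_mult_single:
  "malg_mult M (Poly_Mapping.single x u) (Poly_Mapping.single y v) =
    Poly_Mapping.single (x \<otimes>\<^bsub>M\<^esub> y) (u * v)"
  by (subst malg_mult_eq[of "{x}" "{y}"]) auto

text \<open>Bilinearity in two stages: with a left factor fixed in \<open>B\<close>, the admissible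
  right factors form a subspace; afterwards the admissible left factors do.\<close>

lemma span_malg_mult_closed:
  assumes "\<And>b c. b \<in> B \<Longrightarrow> c \<in> B \<Longrightarrow> malg_mult M b c \<in> malg.span B"
    and "f \<in> malg.span B" "g \<in> malg.span B"
  shows "malg_mult M f g \<in> malg.span B"
proof -
  have *: "malg_mult M b g \<in> malg.span B" if "b \<in> B" for b
    using \<open>g \<in> malg.span B\<close>
  proof (rule malg.span_induct)
    show "malg.subspace {g. malg_mult M b g \<in> malg.span B}"
      by (rule malg.subspaceI)
        (auto simp: malg_mult_add_right malg_mult_scale_right
          intro: malg.span_zero malg.span_add malg.span_scale)
  qed (use assms that in auto)
  show ?thesis
    using \<open>f \<in> malg.span B\<close>
  proof (rule malg.span_induct)
    show "malg.subspace {f. malg_mult M f g \<in> malg.span B}"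
      by (rule malg.subspaceI)
        (auto simp: malg_mult_add_left malg_mult_scale_left
          intro: malg.span_zero malg.span_add malg.span_scale)
  qed (use * in auto)
qed

lemma span_malg_mult_commute:
  assumes "\<And>b c. b \<in> B \<Longrightarrow> c \<in> B \<Longrightarrow> malg_mult M b c = malg_mult M c b"
    and "f \<in> malg.span B" "g \<in> malg.span B"
  shows "malg_mult M f g = malg_mult M g f"
proof -
  have *: "malg_mult M b g = malg_mult M g b" if "b \<in> B" for b
    using \<open>g \<in> malg.span B\<close>
  proof (rule malg.span_induct)
    show "malg.subspace {g. malg_mult M b g = malg_mult M g b}"
      by (rule malg.subspaceI)
        (auto simp: malg_mult_add_right malg_mult_scale_right malg_mult_add_left malg_mult_scale_left)
  qed (use assms that in auto)
  show ?thesis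
    using \<open>f \<in> malg.span B\<close>
  proof (rule malg.span_induct)
    show "malg.subspace {f. malg_mult M f g = malg_mult M g f}"
      by (rule malg.subspaceI)
        (auto simp: malg_mult_add_right malg_mult_scale_right malg_mult_add_left malg_mult_scale_left)
  qed (use * in auto)
qed

section \<open>Level sets, their class sums, and criteria for lumpings\<close>

lemma level_sets_eq: "level_sets M \<mu> = (\<lambda>a. {x \<in> carrier M. \<mu> x = a}) ` \<mu> ` carrier M"
  by (auto simp: level_sets_def)

lemma lookup_sum_single:
  assumes "finite C"
  shows "Poly_Mapping.lookup (\<Sum>x\<in>C. Poly_Mapping.single (f x) (1::rat)) y = of_nat (card {x \<in> C. f x = y})"
proof -
  have "Poly_Mapping.lookup (\<Sum>x\<in>C. Poly_Mapping.single (f x) (1::rat)) y = (\<Sum>x\<in>C. if f x = y then 1 else 0)"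
    by (simp add: lookup_sum lookup_single when_def)
  also have "\<dots> = (\<Sum>x\<in>{x \<in> C. f x = y}. 1)"
    using assms by (rule sum.inter_filter [symmetric])
  finally show ?thesis by simp
qed

lemma lookup_class_sum:
  "finite C \<Longrightarrow> Poly_Mapping.lookup (class_sum C) y = (if y \<in> C then 1 else 0)"
  by (simp add: class_sum_def lookup_sum lookup_single when_def)

text \<open>Level sets are nonempty and pairwise disjoint, so evaluating a vanishing combination at
  a point of one level set isolates the coefficient of its class sum.\<close>

lemma independent_class_sums:
  assumes "\<And>C. C \<in> level_sets M \<mu> \<Longrightarrow> finite C"
  shows "malg.independent (class_sums M \<mu>)"
  unfolding malg.independent_explicit_module
proof (intro allI impI)
  fix S u v
  assume S: "finite S" "S \<subseteq> class_sums M \<mu>" "(\<Sum>v\<in>S. malg_scale (u v) v) = 0" and "v \<in> S"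
  then obtain C where C: "C \<in> level_sets M \<mu>" "v = class_sum C"
    by (auto simp: class_sums_def)
  then obtain y where y: "y \<in> C"
    by (auto simp: level_sets_def)
  have zero: "Poly_Mapping.lookup w y = 0" if "w \<in> S - {v}" for w
  proof -
    have "w \<in> class_sums M \<mu>" using S that by blast
    then obtain D where D: "D \<in> level_sets M \<mu>" "w = class_sum D"
      by (auto simp: class_sums_def)
    then have "D \<noteq> C" using that C by auto
    then have "y \<notin> D" using C D y by (auto simp: level_sets_def)
    then show ?thesis using D assms by (simp add: lookup_class_sum)
  qed
  have "0 = Poly_Mapping.lookup (\<Sum>v\<in>S. malg_scale (u v) v) y"
    using S by simp
  also have "\<dots> = (\<Sum>w\<in>S. u w * Poly_Mapping.lookup w y)"
    by (simp add: lookup_sum)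
  also have "\<dots> = u v * Poly_Mapping.lookup v y + (\<Sum>w\<in>S - {v}. u w * Poly_Mapping.lookup w y)"
    using \<open>v \<in> S\<close> S by (simp add: sum.remove)
  also have "\<dots> = u v"
    using zero C y assms by (simp add: lookup_class_sum)
  finally show "u v = 0" by simp
qed

lemma class_sums_subset_malg_carrier:
  assumes "\<And>C. C \<in> level_sets M \<mu> \<Longrightarrow> finite C"
  shows "class_sums M \<mu> \<subseteq> malg_carrier M"
proof -
  have "Poly_Mapping.keys (class_sum C) \<subseteq> carrier M" if "C \<in> level_sets M \<mu>" for C
    using that assms[OF that]
    by (auto simp: in_keys_iff lookup_class_sum level_sets_def split: if_splits)
  then show ?thesis by (auto simp: class_sums_def malg_carrier_def)
qed

lemma subspace_malg_carrier: "malg.subspace (malg_carrier M)"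
  by (rule malg.subspaceI)
    (use Poly_Mapping.keys_add keys_malg_scale in \<open>fastforce simp: malg_carrier_def\<close>)+

text \<open>Independence of the class sums is automatic once the level sets are finite, so the
  substance of being a lumping is closure of their span under products.\<close>

lemma lumpingI:
  assumes "monoid M" "\<And>C. C \<in> level_sets M \<mu> \<Longrightarrow> finite C"
    and "\<And>f g. f \<in> malg.span (class_sums M \<mu>) \<Longrightarrow> g \<in> malg.span (class_sums M \<mu>) \<Longrightarrow>
      malg_mult M f g \<in> malg.span (class_sums M \<mu>)"
  shows "lumping M \<mu>"
proof -
  have "malg.span (class_sums M \<mu>) \<subseteq> malg_carrier M"
    by (rule malg.span_minimal) (use assms in \<open>simp_all add: class_sums_subset_malg_carrier subspace_malg_carrier\<close>)
  then have "malg_subalgebra M (malg.span (class_sums M \<mu>))"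
    using assms by (simp add: malg_subalgebra_def malg.subspace_span)
  then show ?thesis
    using assms independent_class_sums[of M \<mu>] by (auto simp: lumping_def is_basis_def)
qed

lemma does_the_right_thingI:
  assumes "lumping M \<mu>" "\<And>D. D \<in> level_sets N \<nu> \<Longrightarrow> finite D" "monoid_hom M N f"
    and "malg.span (image_class_sums M \<mu> f) = malg.span (class_sums N \<nu>)"
  shows "does_the_right_thing M \<mu> N \<nu> f"
  using assms malg.span_superset[of "image_class_sums M \<mu> f"]
  by (simp add: does_the_right_thing_def)

text \<open>
  The images of the \<open>\<mu>\<close>-class sums are expressed through the \<open>\<nu>\<close>-class sums by a triangular
  matrix with nonzero diagonal.
\<close>

lemma span_image_class_sums_triangular:
  fixes \<mu> :: "'a \<Rightarrow> nat" and \<nu> :: "'b \<Rightarrow> nat"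
  assumes fin: "finite (carrier N)" "\<And>C. C \<in> level_sets M \<mu> \<Longrightarrow> finite C"
    and f: "\<And>x. x \<in> carrier M \<Longrightarrow> f x \<in> carrier N"
    and count: "\<And>a y. y \<in> carrier N \<Longrightarrow> card {x \<in> carrier M. \<mu> x = a \<and> f x = y} = c a (\<nu> y)"
    and upper: "\<And>a b. b \<in> \<nu> ` carrier N \<Longrightarrow> a < b \<Longrightarrow> c a b = 0"
    and diag: "\<And>b. b \<in> \<nu> ` carrier N \<Longrightarrow> c b b \<noteq> 0"
  shows "malg.span (image_class_sums M \<mu> f) = malg.span (class_sums N \<nu>)"
proof -
  define I where "I a = (\<Sum>x\<in>{x \<in> carrier M. \<mu> x = a}. Poly_Mapping.single (f x) (1::rat))" for a
  define D where "D b = class_sum {y \<in> carrier N. \<nu> y = b}" for b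
  let ?R = "\<nu> ` carrier N"
  have IS: "image_class_sums M \<mu> f = I ` \<mu> ` carrier M"
    by (simp add: image_class_sums_def level_sets_eq image_image I_def)
  have DS: "class_sums N \<nu> = D ` ?R"
    by (simp add: class_sums_def level_sets_eq image_image D_def)
  have I_eq: "I a = (\<Sum>b\<in>?R. malg_scale (of_nat (c a b)) (D b))" if a: "a \<in> \<mu> ` carrier M" for a
  proof (rule poly_mapping_eqI)
    fix y
    have finC: "finite {x \<in> carrier M. \<mu> x = a}"
      using fin(2) a by (auto simp: level_sets_eq)
    have "Poly_Mapping.lookup (\<Sum>b\<in>?R. malg_scale (of_nat (c a b)) (D b)) y =
        (\<Sum>b\<in>?R. if b = \<nu> y then (if y \<in> carrier N then of_nat (c a b) else 0) else 0)"
      using fin(1) by (simp add: lookup_sum D_def lookup_class_sum if_distrib cong: if_cong)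
        (intro sum.cong, auto)
    also have "\<dots> = (if y \<in> carrier N then of_nat (c a (\<nu> y)) else 0)"
      using fin(1) by (simp add: sum.delta)
    also have "\<dots> = Poly_Mapping.lookup (I a) y"
    proof (cases "y \<in> carrier N")
      case True
      then show ?thesis
        using finC by (simp add: I_def lookup_sum_single flip: count)
    next
      case False
      then have none: "{x \<in> {x \<in> carrier M. \<mu> x = a}. f x = y} = {}"
        using f by auto
      show ?thesis
        using False finC by (simp only: I_def lookup_sum_single none) simp
    qed
    finally show "Poly_Mapping.lookup (I a) y =
        Poly_Mapping.lookup (\<Sum>b\<in>?R. malg_scale (of_nat (c a b)) (D b)) y" ..
  qed
  have "image_class_sums M \<mu> f \<subseteq> malg.span (class_sums N \<nu>)"
    unfolding IS DS
    by (auto simp: I_eq simp del: sum.delta intro!: malg.span_sum malg.span_scale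
        intro: malg.span_base[OF imageI])
  \<comment> \<open>Forward substitution: \<open>c b b'\<close> vanishes for \<open>b < b'\<close>,
    so \<open>I b\<close> involves only \<open>D b\<close> and terms \<open>D b'\<close> with
    \<open>b' < b\<close>, and the diagonal entry can be divided out.\<close>
  moreover have "D b \<in> malg.span (image_class_sums M \<mu> f)" if "b \<in> ?R" for b
    using that
  proof (induction b rule: less_induct)
    case (less b)
    obtain y where y: "y \<in> carrier N" "\<nu> y = b" using less by auto
    \<comment> \<open>The nonzero diagonal entry counts preimages of \<open>y\<close>, so
      \<open>b\<close> is itself a value of \<open>\<mu>\<close> and \<open>I b\<close> is one of
      the image class sums.\<close>
    have "card {x \<in> carrier M. \<mu> x = b \<and> f x = y} \<noteq> 0"
      using count[OF y(1), of b] diag[of b] less y by simp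
    then have "{x \<in> carrier M. \<mu> x = b \<and> f x = y} \<noteq> {}"
      by (metis card.empty)
    then have b: "b \<in> \<mu> ` carrier M" by auto
    let ?rest = "\<Sum>b'\<in>?R - {b}. malg_scale (of_nat (c b b')) (D b')"
    have "I b = malg_scale (of_nat (c b b)) (D b) + ?rest"
      using I_eq[OF b] fin(1) less.prems by (simp add: sum.remove)
    then have D_eq: "D b = malg_scale (inverse (of_nat (c b b))) (I b - ?rest)"
      using diag[OF less.prems] by simp
    have "malg_scale (of_nat (c b b')) (D b') \<in> malg.span (image_class_sums M \<mu> f)"
      if "b' \<in> ?R - {b}" for b'
    proof (cases "b' < b")
      case True
      then show ?thesis using less that by (auto intro!: malg.span_scale)
    next
      case False
      then have "c b b' = 0" using upper[of b' b] that by auto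
      then show ?thesis by (simp add: malg.span_zero)
    qed
    then have "?rest \<in> malg.span (image_class_sums M \<mu> f)"
      by (rule malg.span_sum)
    moreover have "I b \<in> malg.span (image_class_sums M \<mu> f)"
      unfolding IS using b by (auto intro!: malg.span_base)
    ultimately show ?case
      unfolding D_eq by (intro malg.span_scale malg.span_diff)
  qed
  then have "class_sums N \<nu> \<subseteq> malg.span (image_class_sums M \<mu> f)"
    by (auto simp: DS)
  ultimately show ?thesis
    by (simp add: malg.span_eq)
qed

text \<open>The linear extension of \<open>g\<close> carries the spans in \<open>span\<close> to the spans in the conclusion.\<close>

lemma span_image_class_sums_comp:
  fixes f :: "'a \<Rightarrow> 'b" and g :: "'b \<Rightarrow> 'd"
  assumes span: "malg.span (image_class_sums M \<mu> f) = malg.span (class_sums N \<nu>)"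
  shows "malg.span (image_class_sums M \<mu> (g \<circ> f)) = malg.span (image_class_sums N \<nu> g)"
proof -
  define push :: "('b \<Rightarrow>\<^sub>0 rat) \<Rightarrow> ('d \<Rightarrow>\<^sub>0 rat)"
    where "push p = (\<Sum>y\<in>Poly_Mapping.keys p. Poly_Mapping.single (g y) (Poly_Mapping.lookup p y))" for p
  have push_eq: "push p = (\<Sum>y\<in>A. Poly_Mapping.single (g y) (Poly_Mapping.lookup p y))"
    if "finite A" "Poly_Mapping.keys p \<subseteq> A" for p A
    unfolding push_def using that by (intro sum.mono_neutral_left) (auto simp: in_keys_iff)
  have add: "push (p + q) = push p + push q" for p q
  proof -
    have "Poly_Mapping.keys (p + q) \<subseteq> Poly_Mapping.keys p \<union> Poly_Mapping.keys q"
      by (rule Poly_Mapping.keys_add)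
    then show ?thesis
      by (simp add: push_eq[of "Poly_Mapping.keys p \<union> Poly_Mapping.keys q"] lookup_add single_add sum.distrib)
  qed
  have scale: "push (malg_scale r p) = malg_scale r (push p)" for r p
    by (simp add: push_eq[of "Poly_Mapping.keys p"] keys_malg_scale malg_scale_sum malg_scale_single)
  interpret push: Vector_Spaces.linear malg_scale malg_scale push
    by (intro Vector_Spaces.linear.intro malg.vector_space_axioms module_hom.intro
        malg.module_axioms module_hom_axioms.intro add scale)
  have single: "push (Poly_Mapping.single y v) = Poly_Mapping.single (g y) v" for y v
    by (subst push_eq[of "{y}"]) auto
  have push_sum: "push (\<Sum>x\<in>C. Poly_Mapping.single (h x) 1) = (\<Sum>x\<in>C. Poly_Mapping.single (g (h x)) 1)"
    for C and h :: "'z \<Rightarrow> 'b"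
    by (simp add: push.sum single)
  have "image_class_sums M \<mu> (g \<circ> f) = push ` image_class_sums M \<mu> f"
    by (auto simp: image_class_sums_def push_sum image_image)
  moreover have "image_class_sums N \<nu> g = push ` class_sums N \<nu>"
    by (auto simp: image_class_sums_def class_sums_def class_sum_def push_sum image_image)
  ultimately show ?thesis
    using span by (simp add: push.span_image)
qed


section \<open>Signed permutations\<close>

abbreviation signed_range :: "nat \<Rightarrow> int set"
  where "signed_range n \<equiv> {i. 1 \<le> \<bar>i\<bar> \<and> \<bar>i\<bar> \<le> int n}"

text \<open>Injectivity of \<open>g\<close> recovers \<open>\<bar>i\<bar>\<close> from
  \<open>f i\<close>, and oddness separates \<open>i\<close> from \<open>- i\<close> because
  \<open>f i\<close> is nonzero. Both the inverse of an oriented ruffle and the signed permutations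
  built from a set of negative places arise this way.\<close>

lemma signed_extension_permutes:
  assumes inj: "inj_on g {1..n}" and g: "\<And>k. k \<in> {1..n} \<Longrightarrow> g k \<in> {1..n}"
    and odd: "\<And>i. f (- i) = - f i"
    and abs: "\<And>i. i \<in> signed_range n \<Longrightarrow> \<bar>f i\<bar> = int (g (nat \<bar>i\<bar>))"
    and outside: "\<And>i. i \<notin> signed_range n \<Longrightarrow> f i = i"
  shows "f permutes signed_range n"
proof (rule bij_imp_permutes)
  have "signed_range n \<subseteq> {- int n..int n}" by auto
  then have fin: "finite (signed_range n)" by (rule finite_subset) simp
  have nat_range: "nat \<bar>i\<bar> \<in> {1..n}" if "i \<in> signed_range n" for i
    using that by (auto simp: nat_le_iff le_nat_iff)
  have range: "f i \<in> signed_range n" if "i \<in> signed_range n" for i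
    using g[OF nat_range[OF that]] by (simp add: abs[OF that])
  have "inj_on f (signed_range n)"
  proof (rule inj_onI)
    fix i j assume ij: "i \<in> signed_range n" "j \<in> signed_range n" and eq: "f i = f j"
    then have "g (nat \<bar>i\<bar>) = g (nat \<bar>j\<bar>)"
      using abs[OF ij(1)] abs[OF ij(2)] by simp
    then have "nat \<bar>i\<bar> = nat \<bar>j\<bar>"
      using inj_onD[OF inj] ij nat_range by blast
    then have "i = j \<or> i = - j" by linarith
    then show "i = j"
      using eq range[OF ij(2)] by (auto simp: odd)
  qed
  moreover have "f ` signed_range n \<subseteq> signed_range n"
    using range by blast
  ultimately show "bij_betw f (signed_range n) (signed_range n)"
    unfolding bij_betw_def using fin by (intro conjI endo_inj_surj)
qed (rule outside)

section \<open>The oriented group and its projection to the symmetric group\<close>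

lemma mem_oriented_group:
  "w \<in> carrier (oriented_group n) \<longleftrightarrow> w permutes signed_range n \<and> (\<forall>i. w (- i) = - w i)"
  by (simp add: oriented_group_def)

lemma oriented_zero: "w \<in> carrier (oriented_group n) \<Longrightarrow> w 0 = 0"
  by (auto simp: mem_oriented_group permutes_not_in)

lemma oriented_in_range:
  assumes "w \<in> carrier (oriented_group n)" "k \<in> {1..n}"
  shows "1 \<le> \<bar>w (int k)\<bar>" "\<bar>w (int k)\<bar> \<le> int n"
  using assms permutes_in_image[of w "signed_range n" "int k"]
  by (auto simp: mem_oriented_group)

lemma forget_in_range:
  assumes "w \<in> carrier (oriented_group n)" "k \<in> {1..n}"
  shows "forget_orientation w k \<in> {1..n}"
  using oriented_in_range[OF assms] by (simp add: forget_orientation_def nat_le_iff le_nat_iff)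

lemma oriented_eq_forget:
  assumes "w \<in> carrier (oriented_group n)" "k \<in> {1..n}"
  shows "w (int k) =
    (if 0 < w (int k) then int (forget_orientation w k) else - int (forget_orientation w k))"
  using oriented_in_range[OF assms] by (simp add: forget_orientation_def)

lemma oriented_inj: "w \<in> carrier (oriented_group n) \<Longrightarrow> w i = w j \<longleftrightarrow> i = j"
  by (auto simp: mem_oriented_group dest: permutes_inj injD)

lemma oriented_eqI:
  assumes v: "v \<in> carrier (oriented_group n)" and w: "w \<in> carrier (oriented_group n)"
    and eq: "\<And>k. k \<in> {1..n} \<Longrightarrow> v (int k) = w (int k)"
  shows "v = w"
proof
  fix i
  show "v i = w i"
  proof (cases "i \<in> signed_range n")
    case True
    then have "nat \<bar>i\<bar> \<in> {1..n}" by (auto simp: nat_le_iff le_nat_iff)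
    moreover have "i = int (nat \<bar>i\<bar>) \<or> i = - int (nat \<bar>i\<bar>)" by auto
    moreover have "v (- j) = - v j" "w (- j) = - w j" for j
      using v w by (simp_all add: mem_oriented_group)
    ultimately show ?thesis
      using eq by metis
  next
    case False
    then show ?thesis
      using v w by (simp add: mem_oriented_group permutes_not_in[OF _ False])
  qed
qed

lemma forget_permutes:
  assumes w: "w \<in> carrier (oriented_group n)"
  shows "forget_orientation w permutes {1..n}"
proof (rule bij_imp_permutes)
  have "inj_on (forget_orientation w) {1..n}"
  proof (rule inj_onI)
    fix i j assume ij: "i \<in> {1..n}" "j \<in> {1..n}" "forget_orientation w i = forget_orientation w j"
    then have "w (int i) = w (int j) \<or> w (int i) = w (- int j)"
      using w by (auto simp: forget_orientation_def mem_oriented_group abs_if split: if_splits)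
    then show "i = j"
      using ij by (auto simp: oriented_inj[OF w])
  qed
  moreover have "forget_orientation w ` {1..n} \<subseteq> {1..n}"
    using forget_in_range[OF w] by blast
  ultimately show "bij_betw (forget_orientation w) {1..n} {1..n}"
    unfolding bij_betw_def by (intro conjI endo_inj_surj) simp_all
  show "forget_orientation w i = i" if "i \<notin> {1..n}" for i
    using that w permutes_not_in[of w "signed_range n" "int i"]
    by (auto simp: mem_oriented_group forget_orientation_def)
qed

text \<open>Oddness of \<open>w\<close> makes \<open>\<bar>w j\<bar>\<close> depend on
  \<open>\<bar>j\<bar>\<close> only, so the signs produced by \<open>v\<close> drop out.\<close>

lemma forget_comp:
  assumes "w \<in> carrier (oriented_group n)"
  shows "forget_orientation (w \<circ> v) = forget_orientation w \<circ> forget_orientation v"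
  using assms by (auto simp: fun_eq_iff forget_orientation_def mem_oriented_group abs_if)

lemma forget_id: "forget_orientation id = id"
  by (simp add: fun_eq_iff forget_orientation_def)

lemma monoid_oriented_group: "monoid (oriented_group n)"
  by unfold_locales
    (auto simp: oriented_group_def comp_assoc permutes_compose permutes_id)

lemma monoid_symmetric_group: "monoid (symmetric_group n)"
  by unfold_locales
    (auto simp: symmetric_group_def comp_assoc permutes_compose permutes_id)

lemma finite_symmetric_group: "finite (carrier (symmetric_group n))"
  by (simp add: symmetric_group_def finite_permutations)

lemma finite_oriented_group: "finite (carrier (oriented_group n))"
proof (rule finite_subset)
  have "signed_range n \<subseteq> {- int n..int n}" by auto
  then show "finite {w. w permutes signed_range n}"
    by (intro finite_permutations) (rule finite_subset, auto)
qed (auto simp: mem_oriented_group)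

lemma monoid_hom_forget_orientation:
  "monoid_hom (oriented_group n) (symmetric_group n) forget_orientation"
proof -
  have "forget_orientation \<in> hom (oriented_group n) (symmetric_group n)"
  proof (rule homI)
    show "forget_orientation w \<in> carrier (symmetric_group n)" if "w \<in> carrier (oriented_group n)" for w
      using forget_permutes[OF that] by (simp add: symmetric_group_def)
    show "forget_orientation (v \<otimes>\<^bsub>oriented_group n\<^esub> w) =
        forget_orientation v \<otimes>\<^bsub>symmetric_group n\<^esub> forget_orientation w"
      if "v \<in> carrier (oriented_group n)" "w \<in> carrier (oriented_group n)" for v w
      using forget_comp[OF that(2)] by (simp add: symmetric_group_def oriented_group_def)
  qed
  then show ?thesis
    using forget_id by (simp add: monoid_hom_def monoid_oriented_group monoid_symmetric_group)
      (simp add: symmetric_group_def oriented_group_def)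
qed


section \<open>Characterization of oriented ruffles\<close>

text \<open>
  Cards \<open>k < l\<close> of one hand satisfy \<open>w k < w l\<close> whether or not the hand was turned over: reversing
  their order and negating both cancel. This is what makes the criterion compatible with products.
\<close>

definition feeds :: "nat \<Rightarrow> (nat \<Rightarrow> nat) \<Rightarrow> (int \<Rightarrow> int) \<Rightarrow> bool"
  where "feeds n x w \<longleftrightarrow> w \<in> carrier (oriented_group n) \<and>
    (\<forall>k\<in>{1..n}. even (x (forget_orientation w k)) \<longleftrightarrow> 0 < w (int k)) \<and>
    (\<forall>k\<in>{1..n}. \<forall>l\<in>{1..n}. k < l \<longrightarrow>
      x (forget_orientation w k) < x (forget_orientation w l) \<or>
      x (forget_orientation w k) = x (forget_orientation w l) \<and> w (int k) < w (int l))"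

text \<open>For final positions \<open>i\<close> and \<open>j\<close>: the card ending in
  \<open>i\<close> originally lies in front of the card ending in \<open>j\<close>. The reversal in
  odd hands is the turning over of the bunch.\<close>

definition before :: "(nat \<Rightarrow> nat) \<Rightarrow> nat \<Rightarrow> nat \<Rightarrow> bool"
  where "before x i j \<longleftrightarrow> x i < x j \<or> x i = x j \<and> (if even (x i) then i < j else j < i)"

lemma before_irrefl [simp]: "\<not> before x i i"
  by (simp add: before_def)

lemma before_trans: "before x i j \<Longrightarrow> before x j k \<Longrightarrow> before x i k"
  by (auto simp: before_def split: if_splits)

lemma before_total: "i \<noteq> j \<Longrightarrow> before x i j \<or> before x j i"
  by (auto simp: before_def)

text \<open>The original position of the card that ends in position \<open>i\<close>; counting
  \<open>i\<close> itself makes the ranks start at 1.\<close>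

definition rank :: "nat \<Rightarrow> (nat \<Rightarrow> nat) \<Rightarrow> nat \<Rightarrow> nat"
  where "rank n x i = card {i' \<in> {1..n}. i' = i \<or> before x i' i}"

lemma rank_less:
  assumes "j \<in> {1..n}" "before x i j"
  shows "rank n x i < rank n x j"
  unfolding rank_def
proof (rule psubset_card_mono)
  show "{i' \<in> {1..n}. i' = i \<or> before x i' i} \<subset> {i' \<in> {1..n}. i' = j \<or> before x i' j}"
  proof
    show "{i' \<in> {1..n}. i' = i \<or> before x i' i} \<subseteq> {i' \<in> {1..n}. i' = j \<or> before x i' j}"
      using assms before_trans by blast
    have "j \<noteq> i" "\<not> before x j i"
      using assms before_trans before_irrefl by blast+
    then show "{i' \<in> {1..n}. i' = i \<or> before x i' i} \<noteq> {i' \<in> {1..n}. i' = j \<or> before x i' j}"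
      using assms by blast
  qed
qed simp

lemma rank_less_iff:
  assumes "i \<in> {1..n}" "j \<in> {1..n}"
  shows "rank n x i < rank n x j \<longleftrightarrow> before x i j"
  using assms rank_less[of j n x i] rank_less[of i n x j] before_total[of i j x]
  by (metis less_asym less_irrefl)

lemma rank_inj_on: "inj_on (rank n x) {1..n}"
proof (rule inj_onI)
  fix i j assume "i \<in> {1..n}" "j \<in> {1..n}" "rank n x i = rank n x j"
  then show "i = j"
    using rank_less_iff[of i n j x] rank_less_iff[of j n i x] before_total[of i j x] by auto
qed

lemma rank_in_range:
  assumes "i \<in> {1..n}"
  shows "rank n x i \<in> {1..n}"
proof -
  have "0 < rank n x i"
    unfolding rank_def using assms by (subst card_gt_0_iff) auto
  moreover have "rank n x i \<le> card {1..n}"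
    unfolding rank_def by (rule card_mono) auto
  ultimately show ?thesis by simp
qed

lemma sum_hand_size: "(\<Sum>k<j. hand_size n x k) = card {i \<in> {1..n}. x i < j}"
proof (induction j)
  case (Suc j)
  have "{i \<in> {1..n}. x i < Suc j} = {i \<in> {1..n}. x i < j} \<union> {i \<in> {1..n}. x i = j}" by auto
  then have "card {i \<in> {1..n}. x i < Suc j} = card {i \<in> {1..n}. x i < j} + card {i \<in> {1..n}. x i = j}"
    by (simp only:) (rule card_Un_disjoint, auto)
  then show ?case using Suc by (simp add: hand_size_def)
qed simp

text \<open>The cards in front of the given one are those of lower hands together with those of its
  own hand at earlier final positions if the hand is even, at later ones if it is odd.\<close>

lemma dealt_card_eq:
  assumes i: "i \<in> {1..n}"
  shows "dealt_card n x i = (if even (x i) then int (rank n x i) else - int (rank n x i))"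
proof -
  let ?j = "x i"
  let ?S = "{i' \<in> {1..n}. x i' < ?j}" and ?C = "{i' \<in> {1..n}. x i' = ?j}"
  let ?R = "{i' \<in> {1..i}. x i' = ?j}" and ?Q = "{i' \<in> {i..n}. x i' = ?j}"
  show ?thesis
  proof (cases "even ?j")
    case True
    have "{i' \<in> {1..n}. i' = i \<or> before x i' i} = ?S \<union> ?R"
      using i True by (auto simp: before_def)
    then have "rank n x i = card ?S + card ?R"
      unfolding rank_def by (simp only:) (rule card_Un_disjoint, auto)
    then show ?thesis
      using True by (simp add: dealt_card_def Let_def sum_hand_size)
  next
    case False
    have "{i' \<in> {1..n}. i' = i \<or> before x i' i} = ?S \<union> ?Q"
      using i False by (auto simp: before_def)
    then have rank: "rank n x i = card ?S + card ?Q"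
      unfolding rank_def by (simp only:) (rule card_Un_disjoint, auto)
    \<comment> \<open>Both ranges contain \<open>i\<close>. This overlap is the \<open>+ 1\<close>
      in \<open>s + c + 1 - r\<close>, which therefore equals
      \<open>card ?S + card ?Q\<close>.\<close>
    have "{1..n} = {1..i} \<union> {i..n}" "{1..i} \<inter> {i..n} = {i}"
      using i by auto
    then have "?C = ?R \<union> ?Q" "?R \<inter> ?Q = {i}"
      by blast+
    then have "card ?C + 1 = card ?R + card ?Q"
      using card_Un_Int[of ?R ?Q] by simp
    then show ?thesis
      unfolding dealt_card_def Let_def sum_hand_size unfolding hand_size_def
      using False rank by simp
  qed
qed

section \<open>The oriented ruffle is the unique signed permutation satisfying
  \<open>feeds\<close>\<close>

lemma oriented_origin_odd: "oriented_origin n x (- i) = - oriented_origin n x i"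
  by (simp add: oriented_origin_def sgn_minus)

lemma abs_oriented_origin:
  assumes "i \<in> signed_range n"
  shows "\<bar>oriented_origin n x i\<bar> = int (rank n x (nat \<bar>i\<bar>))"
proof -
  have "nat \<bar>i\<bar> \<in> {1..n}" "\<bar>sgn i\<bar> = 1"
    using assms by (auto simp: nat_le_iff le_nat_iff abs_sgn_eq)
  then show ?thesis
    using assms by (simp add: oriented_origin_def dealt_card_eq abs_mult)
qed

lemma oriented_origin_permutes: "oriented_origin n x permutes signed_range n"
  using rank_inj_on rank_in_range oriented_origin_odd abs_oriented_origin
  by (rule signed_extension_permutes) (auto simp: oriented_origin_def)

lemma orientedruffle_in_oriented_group: "orientedruffle n (a, x) \<in> carrier (oriented_group n)"
proof -
  let ?O = "oriented_origin n x"
  have "inv_into UNIV ?O permutes signed_range n"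
    using oriented_origin_permutes by (rule permutes_inv)
  moreover have "inv_into UNIV ?O (- i) = - inv_into UNIV ?O i" for i
  proof -
    have "?O (- inv_into UNIV ?O i) = - i"
      by (simp add: oriented_origin_odd permutes_inverses(1)[OF oriented_origin_permutes])
    then show ?thesis
      by (metis permutes_inverses(2)[OF oriented_origin_permutes])
  qed
  ultimately show ?thesis by (simp add: orientedruffle_def mem_oriented_group)
qed

text \<open>Two signs multiply here, that of \<open>w k\<close> and that of the dealt card; the
  second is given by the parity of the hand.\<close>

lemma oriented_origin_oriented:
  assumes w: "w \<in> carrier (oriented_group n)" and k: "k \<in> {1..n}"
  shows "oriented_origin n x (w (int k)) =
    (if even (x (forget_orientation w k)) \<longleftrightarrow> 0 < w (int k) then int (rank n x (forget_orientation w k))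
     else - int (rank n x (forget_orientation w k)))"
  using oriented_in_range[OF w k] dealt_card_eq[OF forget_in_range[OF w k], of x]
  by (auto simp: oriented_origin_def forget_orientation_def sgn_if)

text \<open>The origin of \<open>?w k\<close> is the positive number \<open>k\<close>. Comparing
  signs gives the parity condition, comparing absolute values gives rank \<open>k\<close>, and the
  order of the ranks is \<open>before\<close>.\<close>

lemma feeds_orientedruffle: "feeds n x (orientedruffle n (a, x))"
proof -
  let ?w = "orientedruffle n (a, x)"
  note w = orientedruffle_in_oriented_group[of n a x]
  have "oriented_origin n x (?w i) = i" for i
    by (simp add: orientedruffle_def permutes_inverses(1)[OF oriented_origin_permutes])
  then have "int k = (if even (x (forget_orientation ?w k)) \<longleftrightarrow> 0 < ?w (int k)
      then int (rank n x (forget_orientation ?w k)) else - int (rank n x (forget_orientation ?w k)))"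
    if "k \<in> {1..n}" for k
    using oriented_origin_oriented[OF w that, of x] by simp
  then have sign: "even (x (forget_orientation ?w k)) \<longleftrightarrow> 0 < ?w (int k)"
    and rank: "rank n x (forget_orientation ?w k) = k" if "k \<in> {1..n}" for k
    using that by (fastforce split: if_splits)+
  have "x (forget_orientation ?w k) < x (forget_orientation ?w l) \<or>
      x (forget_orientation ?w k) = x (forget_orientation ?w l) \<and> ?w (int k) < ?w (int l)"
    if kl: "k \<in> {1..n}" "l \<in> {1..n}" "k < l" for k l
  proof -
    have "before x (forget_orientation ?w k) (forget_orientation ?w l)"
      using rank_less_iff[OF forget_in_range[OF w kl(1)] forget_in_range[OF w kl(2)], of x] rank kl
      by simp
    then show ?thesis
      using sign[OF kl(1)] sign[OF kl(2)] oriented_eq_forget[OF w kl(1)] oriented_eq_forget[OF w kl(2)]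
      by (auto simp: before_def split: if_splits)
  qed
  then show ?thesis using w sign by (auto simp: feeds_def)
qed

text \<open>The conditions sort the positions \<open>?p 1, \<dots>, ?p n\<close> by
  \<open>before\<close>. Hence \<open>?p k\<close> has rank \<open>k\<close>, and \<open>w\<close>
  inverts \<open>oriented_origin\<close>. The number \<open>a\<close> is arbitrary, as an oriented
  ruffle depends only on \<open>x\<close>.\<close>

lemma feeds_unique:
  assumes "feeds n x w"
  shows "w = orientedruffle n (a, x)"
proof -
  let ?p = "forget_orientation w"
  have w: "w \<in> carrier (oriented_group n)"
    and sign: "\<And>k. k \<in> {1..n} \<Longrightarrow> even (x (?p k)) \<longleftrightarrow> 0 < w (int k)"
    using assms by (auto simp: feeds_def)
  have before: "before x (?p k) (?p l)" if kl: "k \<in> {1..n}" "l \<in> {1..n}" "k < l" for k l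
  proof -
    have "x (?p k) < x (?p l) \<or> x (?p k) = x (?p l) \<and> w (int k) < w (int l)"
      using assms kl by (simp add: feeds_def)
    then show ?thesis
      using sign[OF kl(1)] sign[OF kl(2)] oriented_eq_forget[OF w kl(1)] oriented_eq_forget[OF w kl(2)]
      by (auto simp: before_def)
  qed
  have pos: "oriented_origin n x (w (int k)) = int k" if k: "k \<in> {1..n}" for k
  proof -
    have "{i \<in> {1..n}. i = ?p k \<or> before x i (?p k)} = ?p ` {1..k}"
    proof (intro equalityI subsetI)
      fix i assume i: "i \<in> {i \<in> {1..n}. i = ?p k \<or> before x i (?p k)}"
      then obtain l where l: "l \<in> {1..n}" "i = ?p l"
        using permutes_image[OF forget_permutes[OF w]] by blast
      have "l \<le> k"
      proof (rule ccontr)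
        assume "\<not> l \<le> k"
        then have "before x (?p k) (?p l)" using before k l by simp
        then show False using i l before_trans[of x "?p k" "?p l" "?p k"] by auto
      qed
      then show "i \<in> ?p ` {1..k}" using l by auto
    next
      fix i assume "i \<in> ?p ` {1..k}"
      then obtain l where l: "l \<in> {1..k}" "i = ?p l" by auto
      then have "l \<in> {1..n}" using k by auto
      moreover have "l = k \<or> l < k" using l by auto
      ultimately show "i \<in> {i \<in> {1..n}. i = ?p k \<or> before x i (?p k)}"
        using before[of l k] forget_in_range[OF w, of l] k l by auto
    qed
    then have "rank n x (?p k) = k"
      using card_image[OF inj_on_subset[OF permutes_inj_on[OF forget_permutes[OF w], of UNIV]], of "{1..k}"]
      by (simp add: rank_def)
    then show ?thesis
      using oriented_origin_oriented[OF w k, of x] sign[OF k] by simp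
  qed
  have "w (int k) = orientedruffle n (a, x) (int k)" if k: "k \<in> {1..n}" for k
    using permutes_inverses(2)[OF oriented_origin_permutes, of n x "w (int k)"] pos[OF k]
    by (simp add: orientedruffle_def)
  then show ?thesis
    by (rule oriented_eqI[OF w orientedruffle_in_oriented_group])
qed

lemma eq_orientedruffle_iff: "w = orientedruffle n (a, x) \<longleftrightarrow> feeds n x w"
  using feeds_orientedruffle feeds_unique by metis


section \<open>The ruffle monoid\<close>

text \<open>The hand of a product of ruffles: every hand \<open>p\<close> splits into
  \<open>b\<close> subhands, which are numbered backwards if \<open>p\<close> is odd.\<close>

definition enc :: "nat \<Rightarrow> nat \<Rightarrow> nat \<Rightarrow> nat"
  where "enc b p q = (if even p then b * p + q else b * p + b - 1 - q)"

text \<open>Writing \<open>b = q + d + 1\<close> turns the reflection \<open>b - 1 - q\<close> into the subtraction-free \<open>d\<close>.\<close>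

lemma enc_Suc: "enc (Suc (q + d)) p q = Suc (q + d) * p + (if even p then q else d)"
  by (simp add: enc_def)

lemma enc_less:
  assumes "q < b" "q' < b" "p < p'"
  shows "enc b p q < enc b p' q'"
proof -
  have "b * p + b \<le> b * p'"
    using \<open>p < p'\<close> by (metis Suc_leI add.commute mult_Suc_right mult_le_mono2)
  moreover have "enc b p q < b * p + b" "b * p' \<le> enc b p' q'"
    using assms by (auto simp: enc_def)
  ultimately show ?thesis by linarith
qed

lemma enc_bound:
  assumes "q < b" "p < a"
  shows "enc b p q < a * b"
proof -
  have "b * p + b \<le> b * a"
    using \<open>p < a\<close> by (metis Suc_leI add.commute mult_Suc_right mult_le_mono2)
  moreover have "enc b p q < b * p + b"
    using assms by (auto simp: enc_def)
  ultimately show ?thesis by (simp add: mult.commute)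
qed

text \<open>For odd \<open>p\<close> the parity is that of \<open>b + d = q + 2 * d + 1\<close>,
  opposite to that of \<open>q\<close> whatever the parity of \<open>b\<close>.\<close>

lemma even_enc:
  assumes "q < b"
  shows "even (enc b p q) \<longleftrightarrow> (even p \<longleftrightarrow> even q)"
proof -
  obtain d where b: "b = Suc (q + d)"
    using assms less_imp_Suc_add by auto
  show ?thesis unfolding b enc_Suc by auto
qed

lemma enc_inject:
  assumes "q < b" "q' < b" "enc b p q = enc b p' q'"
  shows "p = p' \<and> q = q'"
proof -
  have "p = p'"
    using enc_less[of q b q' p p'] enc_less[of q' b q p' p] assms by (metis less_irrefl linorder_neqE_nat)
  then show ?thesis
    using assms by (auto simp: enc_def split: if_splits)
qed

text \<open>Both sides number a three-level subdivision. A reflection at the outer level reverses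
  the middle and the inner level together.\<close>

lemma enc_assoc:
  assumes "q < b" "r < c"
  shows "enc c (enc b p q) r = enc (b * c) p (enc c q r)"
proof -
  obtain d e where b: "b = Suc (q + d)" and c: "c = Suc (r + e)"
    using assms less_imp_Suc_add by metis
  define u where "u = enc c q r"
  have u: "u = c * q + (if even q then r else e)"
    unfolding u_def c enc_Suc ..
  \<comment> \<open>The reflection \<open>b * c - 1 - u\<close> of \<open>u\<close> has both digits
    reflected: \<open>d\<close> replaces \<open>q\<close>, and the inner offset \<open>r\<close> or
    \<open>e\<close> is replaced by the other one.\<close>
  have "b * c = Suc (u + ((if even q then e else r) + c * d))"
    unfolding u b by (auto simp: c algebra_simps)
  then have "enc (b * c) p u = (b * c) * p + (if even p then u else (if even q then e else r) + c * d)"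
    using enc_Suc by metis
  moreover have "enc c (enc b p q) r = c * enc b p q + (if even p \<longleftrightarrow> even q then r else e)"
    unfolding c enc_Suc even_enc[OF assms(1)] by simp
  moreover have "enc b p q = b * p + (if even p then q else d)"
    unfolding b enc_Suc ..
  ultimately show ?thesis
    unfolding u_def[symmetric] by (auto simp: u algebra_simps)
qed

section \<open>Multiplication of ruffles, its compatibility with composition, and
  associativity\<close>

lemma act_apply: "\<sigma> permutes S \<Longrightarrow> act x \<sigma> (\<sigma> i) = x i"
  by (simp add: act_def permutes_inverses(2))

lemma act_id [simp]: "act x id = x"
  by (simp add: act_def fun_eq_iff)

lemma act_comp:
  assumes "\<sigma> permutes S" "\<tau> permutes S"
  shows "act x (\<tau> \<circ> \<sigma>) = act (act x \<sigma>) \<tau>"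
  by (simp add: act_def comp_assoc o_inv_distrib[OF permutes_bij[OF assms(2)] permutes_bij[OF assms(1)]])

lemma inv_permutes_in_range:
  "\<sigma> permutes S \<Longrightarrow> i \<in> S \<Longrightarrow> inv_into UNIV \<sigma> i \<in> S"
  by (metis permutes_in_image permutes_inv)

lemma ruffle_permutes: "ruffle n p permutes {1..n}"
  unfolding ruffle_def by (cases p) (simp only: forget_permutes orientedruffle_in_oriented_group)

lemma ruffle_mult_eq:
  "ruffle_mult n (a, x) (b, y) = (a * b, \<lambda>i\<in>{1..n}. enc b (act x (ruffle n (b, y)) i) (y i))"
  by (simp add: ruffle_mult_def enc_def Let_def)

lemma mem_ruffle_monoid:
  "(a, x) \<in> carrier (ruffle_monoid n) \<longleftrightarrow> 1 \<le> a \<and> x \<in> {1..n} \<rightarrow>\<^sub>E {..<a}"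
  by (simp add: ruffle_monoid_def)

lemma act_less:
  assumes "x \<in> {1..n} \<rightarrow>\<^sub>E {..<a}" "i \<in> {1..n}"
  shows "act x (ruffle n p) i < a"
  using assms inv_permutes_in_range[OF ruffle_permutes[of n p] assms(2)]
  by (auto simp: act_def PiE_iff)

lemma ruffle_mult_closed:
  assumes "p \<in> carrier (ruffle_monoid n)" "q \<in> carrier (ruffle_monoid n)"
  shows "ruffle_mult n p q \<in> carrier (ruffle_monoid n)"
proof -
  obtain a x b y where "p = (a, x)" "q = (b, y)" by (cases p, cases q)
  then show ?thesis
    using assms by (auto simp: ruffle_mult_eq mem_ruffle_monoid act_less PiE_iff
        intro!: enc_bound simp del: atLeastAtMost_iff)
qed

text \<open>Card \<open>k\<close> passes position \<open>?s k\<close> on its way to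
  \<open>?t (?s k)\<close>, so its combined hand is its \<open>x\<close>-hand refined by the
  \<open>y\<close>-hand of that position. Parities combine as signs multiply, and hands are compared
  lexicographically.\<close>

lemma feeds_comp:
  assumes w: "feeds n x w" and v: "feeds n y v" and y: "y \<in> {1..n} \<rightarrow>\<^sub>E {..<b}"
  shows "feeds n (\<lambda>i\<in>{1..n}. enc b (act x (forget_orientation v) i) (y i)) (v \<circ> w)"
proof -
  let ?z = "\<lambda>i\<in>{1..n}. enc b (act x (forget_orientation v) i) (y i)"
  let ?s = "forget_orientation w" and ?t = "forget_orientation v"
  have wG: "w \<in> carrier (oriented_group n)" and vG: "v \<in> carrier (oriented_group n)"
    using w v by (auto simp: feeds_def)
  have wv: "v \<circ> w \<in> carrier (oriented_group n)"
    using wG vG by (auto simp: mem_oriented_group permutes_compose)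
  have odd_v: "v (- i) = - v i" for i
    using vG by (simp add: mem_oriented_group)
  have z: "?z (forget_orientation (v \<circ> w) k) = enc b (x (?s k)) (y (?t (?s k)))"
    and y_less: "y (?t (?s k)) < b" and s: "?s k \<in> {1..n}" if "k \<in> {1..n}" for k
  proof -
    show s: "?s k \<in> {1..n}" using forget_in_range[OF wG that] .
    then have t: "?t (?s k) \<in> {1..n}" using forget_in_range[OF vG] by blast
    then show "y (?t (?s k)) < b" using y by (auto simp: PiE_iff)
    show "?z (forget_orientation (v \<circ> w) k) = enc b (x (?s k)) (y (?t (?s k)))"
      using t by (simp add: forget_comp[OF vG] act_apply[OF forget_permutes[OF vG]])
  qed
  have vw: "v (w (int k)) = (if even (x (?s k)) then v (int (?s k)) else - v (int (?s k)))"
    if "k \<in> {1..n}" for k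
    using that w oriented_eq_forget[OF wG that] by (metis feeds_def odd_v)
  have v_nonzero: "v (int i) \<noteq> 0" if "i \<in> {1..n}" for i
    using oriented_in_range[OF vG that] by auto
  have "even (?z (forget_orientation (v \<circ> w) k)) \<longleftrightarrow> 0 < (v \<circ> w) (int k)" if k: "k \<in> {1..n}" for k
  proof -
    have "even (y (?t (?s k))) \<longleftrightarrow> 0 < v (int (?s k))"
      using v s[OF k] unfolding feeds_def by blast
    then show ?thesis
      using vw[OF k] v_nonzero[OF s[OF k]] unfolding z[OF k] even_enc[OF y_less[OF k]] by auto
  qed
  moreover have "?z (forget_orientation (v \<circ> w) k) < ?z (forget_orientation (v \<circ> w) l) \<or>
      ?z (forget_orientation (v \<circ> w) k) = ?z (forget_orientation (v \<circ> w) l) \<and>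
      (v \<circ> w) (int k) < (v \<circ> w) (int l)"
    if kl: "k \<in> {1..n}" "l \<in> {1..n}" "k < l" for k l
    unfolding z[OF kl(1)] z[OF kl(2)]
  proof (cases "x (?s k) < x (?s l)")
    case True
    then show "enc b (x (?s k)) (y (?t (?s k))) < enc b (x (?s l)) (y (?t (?s l))) \<or>
      enc b (x (?s k)) (y (?t (?s k))) = enc b (x (?s l)) (y (?t (?s l))) \<and> (v \<circ> w) (int k) < (v \<circ> w) (int l)"
      using enc_less y_less kl by blast
  next
    case False
    then have eq: "x (?s k) = x (?s l)" and less: "w (int k) < w (int l)"
      using w kl unfolding feeds_def by blast+
    have sign: "even (x (?s k)) \<longleftrightarrow> 0 < w (int k)" "even (x (?s l)) \<longleftrightarrow> 0 < w (int l)"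
      using w kl unfolding feeds_def by blast+
    show "enc b (x (?s k)) (y (?t (?s k))) < enc b (x (?s l)) (y (?t (?s l))) \<or>
      enc b (x (?s k)) (y (?t (?s k))) = enc b (x (?s l)) (y (?t (?s l))) \<and> (v \<circ> w) (int k) < (v \<circ> w) (int l)"
    proof (cases "even (x (?s k))")
      case True
      then have "?s k < ?s l"
        using less sign eq oriented_eq_forget[OF wG kl(1)] oriented_eq_forget[OF wG kl(2)] by simp
      then have "y (?t (?s k)) < y (?t (?s l)) \<or> y (?t (?s k)) = y (?t (?s l)) \<and> v (int (?s k)) < v (int (?s l))"
        using v s kl unfolding feeds_def by blast
      then show ?thesis
        using True eq vw[OF kl(1)] vw[OF kl(2)] by (auto simp: enc_def)
    next
      case False
      \<comment> \<open>In an odd hand \<open>w\<close> increases while the positions decrease. The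
        comparison given by \<open>v\<close> is thus reversed, and it is reversed back by the
        reflection \<open>b - 1 - y\<close> and by the sign in \<open>vw\<close>.\<close>
      then have "?s l < ?s k"
        using less sign eq oriented_eq_forget[OF wG kl(1)] oriented_eq_forget[OF wG kl(2)] by simp
      then have "y (?t (?s l)) < y (?t (?s k)) \<or> y (?t (?s l)) = y (?t (?s k)) \<and> v (int (?s l)) < v (int (?s k))"
        using v s kl unfolding feeds_def by blast
      then show ?thesis
        using False eq vw[OF kl(1)] vw[OF kl(2)] y_less[OF kl(1)] y_less[OF kl(2)] by (auto simp: enc_def)
    qed
  qed
  ultimately show ?thesis
    using wv unfolding feeds_def by blast
qed

lemma orientedruffle_mult:
  assumes "p \<in> carrier (ruffle_monoid n)" "q \<in> carrier (ruffle_monoid n)"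
  shows "orientedruffle n (ruffle_mult n p q) = orientedruffle n q \<circ> orientedruffle n p"
proof -
  obtain a x b y where [simp]: "p = (a, x)" "q = (b, y)" by (cases p, cases q)
  have "y \<in> {1..n} \<rightarrow>\<^sub>E {..<b}"
    using assms by (simp add: mem_ruffle_monoid)
  then have "feeds n (\<lambda>i\<in>{1..n}. enc b (act x (ruffle n (b, y)) i) (y i))
      (orientedruffle n (b, y) \<circ> orientedruffle n (a, x))"
    unfolding ruffle_def by (intro feeds_comp feeds_orientedruffle)
  then show ?thesis
    by (simp add: ruffle_mult_eq flip: eq_orientedruffle_iff[of _ _ "a * b"])
qed

lemma orientedruffle_one: "orientedruffle n (1, \<lambda>i\<in>{1..n}. 0) = id"
proof -
  have "feeds n (\<lambda>i\<in>{1..n}. 0) id"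
    by (simp add: feeds_def mem_oriented_group permutes_id forget_id)
  then show ?thesis by (metis eq_orientedruffle_iff)
qed

lemma ruffle_mult_hom:
  assumes "p \<in> carrier (ruffle_monoid n)" "q \<in> carrier (ruffle_monoid n)"
  shows "ruffle n (ruffle_mult n p q) = ruffle n q \<circ> ruffle n p"
  using assms
  by (cases q) (simp add: ruffle_def orientedruffle_mult forget_comp[OF orientedruffle_in_oriented_group])

lemma ruffle_one: "ruffle n (1, \<lambda>i\<in>{1..n}. 0) = id"
  unfolding ruffle_def orientedruffle_one forget_id ..

lemma ruffle_mult_assoc:
  assumes p: "p \<in> carrier (ruffle_monoid n)" and q: "q \<in> carrier (ruffle_monoid n)"
    and r: "r \<in> carrier (ruffle_monoid n)"
  shows "ruffle_mult n (ruffle_mult n p q) r = ruffle_mult n p (ruffle_mult n q r)"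
proof -
  obtain a x b y c z where eq: "p = (a, x)" "q = (b, y)" "r = (c, z)" by (cases p, cases q, cases r)
  let ?s = "ruffle n (b, y)" and ?t = "ruffle n (c, z)"
  let ?xy = "\<lambda>i\<in>{1..n}. enc b (act x ?s i) (y i)"
  let ?yz = "\<lambda>i\<in>{1..n}. enc c (act y ?t i) (z i)"
  \<comment> \<open>The homomorphism property identifies the permutation by which the right-hand
    product moves \<open>x\<close>. Associativity then reduces to that of \<open>enc\<close>, read
    off at position \<open>?j\<close> before the last ruffle.\<close>
  have hom: "ruffle n (b * c, ?yz) = ?t \<circ> ?s"
    using ruffle_mult_hom[OF q r] by (simp add: eq ruffle_mult_eq)
  have "enc c (act ?xy ?t i) (z i) = enc (b * c) (act x (?t \<circ> ?s) i) (enc c (act y ?t i) (z i))"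
    if i: "i \<in> {1..n}" for i
  proof -
    let ?j = "inv_into UNIV ?t i"
    have j: "?j \<in> {1..n}"
      using inv_permutes_in_range[OF ruffle_permutes i] .
    have "act ?xy ?t i = enc b (act x ?s ?j) (y ?j)"
      using j by (simp add: act_def)
    moreover have "act x (?t \<circ> ?s) i = act x ?s ?j"
      by (simp add: act_comp[OF ruffle_permutes ruffle_permutes]) (simp add: act_def)
    moreover have "act y ?t i = y ?j" by (simp add: act_def)
    moreover have "y ?j < b" "z i < c"
      using q r i j by (auto simp: eq mem_ruffle_monoid PiE_iff simp del: atLeastAtMost_iff)
    ultimately show ?thesis by (simp only: enc_assoc)
  qed
  then show ?thesis
    unfolding eq ruffle_mult_eq hom by (simp only: prod.inject mult.assoc) (auto intro: restrict_ext)
qed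

lemma monoid_ruffle_monoid: "monoid (ruffle_monoid n)"
proof
  let ?M = "ruffle_monoid n"
  have simps: "\<one>\<^bsub>?M\<^esub> = (1, \<lambda>i\<in>{1..n}. 0)" "\<And>p q. p \<otimes>\<^bsub>?M\<^esub> q = ruffle_mult n p q"
    by (simp_all add: ruffle_monoid_def)
  show "\<one>\<^bsub>?M\<^esub> \<in> carrier ?M"
    unfolding simps by (simp add: mem_ruffle_monoid)
  show "p \<otimes>\<^bsub>?M\<^esub> q \<in> carrier ?M" if "p \<in> carrier ?M" "q \<in> carrier ?M" for p q
    unfolding simps using that by (rule ruffle_mult_closed)
  show "p \<otimes>\<^bsub>?M\<^esub> q \<otimes>\<^bsub>?M\<^esub> r = p \<otimes>\<^bsub>?M\<^esub> (q \<otimes>\<^bsub>?M\<^esub> r)"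
    if "p \<in> carrier ?M" "q \<in> carrier ?M" "r \<in> carrier ?M" for p q r
    unfolding simps using that by (rule ruffle_mult_assoc)
  fix p assume "p \<in> carrier ?M"
  then obtain a x where p: "p = (a, x)" "x \<in> {1..n} \<rightarrow>\<^sub>E {..<a}"
    by (cases p) (simp add: mem_ruffle_monoid)
  have "act (\<lambda>i\<in>{1..n}. 0) (ruffle n (a, x)) i = 0" if "i \<in> {1..n}" for i
    using inv_permutes_in_range[OF ruffle_permutes that] by (simp add: act_def)
  then have "(\<lambda>i\<in>{1..n}. enc a (act (\<lambda>i\<in>{1..n}. 0) (ruffle n (a, x)) i) (x i)) = (\<lambda>i\<in>{1..n}. x i)"
    by (intro restrict_ext) (simp add: enc_def)
  then show "\<one>\<^bsub>?M\<^esub> \<otimes>\<^bsub>?M\<^esub> p = p"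
    unfolding simps p(1) ruffle_mult_eq using p(2) by (simp add: PiE_restrict)
  have "(\<lambda>i\<in>{1..n}. enc 1 (act x (ruffle n (1, \<lambda>i\<in>{1..n}. 0)) i) ((\<lambda>i\<in>{1..n}. 0) i)) = (\<lambda>i\<in>{1..n}. x i)"
    unfolding ruffle_one act_id by (intro restrict_ext) (simp add: enc_def)
  then show "p \<otimes>\<^bsub>?M\<^esub> \<one>\<^bsub>?M\<^esub> = p"
    unfolding simps p(1) ruffle_mult_eq using p(2) by (simp add: PiE_restrict)
qed

lemma monoid_hom_orientedruffle:
  "monoid_hom (ruffle_monoid n) (oriented_group n) (orientedruffle n)"
proof -
  have "orientedruffle n \<in> hom (ruffle_monoid n) (oriented_group n)"
  proof (rule homI)
    show "orientedruffle n p \<in> carrier (oriented_group n)" for p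
      by (cases p) (simp add: orientedruffle_in_oriented_group)
    show "orientedruffle n (p \<otimes>\<^bsub>ruffle_monoid n\<^esub> q) =
        orientedruffle n p \<otimes>\<^bsub>oriented_group n\<^esub> orientedruffle n q"
      if "p \<in> carrier (ruffle_monoid n)" "q \<in> carrier (ruffle_monoid n)" for p q
      using orientedruffle_mult[OF that] by (simp add: ruffle_monoid_def oriented_group_def)
  qed
  moreover have "orientedruffle n \<one>\<^bsub>ruffle_monoid n\<^esub> = \<one>\<^bsub>oriented_group n\<^esub>"
    using orientedruffle_one[of n] by (simp add: ruffle_monoid_def oriented_group_def)
  ultimately show ?thesis
    by (simp add: monoid_hom_def monoid_ruffle_monoid monoid_oriented_group)
qed

lemma monoid_hom_comp:
  assumes "monoid_hom L M f" "monoid_hom M N g"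
  shows "monoid_hom L N (g \<circ> f)"
  using assms by (auto simp: monoid_hom_def hom_def Pi_iff)

lemma ruffle_eq_comp: "ruffle n = forget_orientation \<circ> orientedruffle n"
  by (simp add: ruffle_def fun_eq_iff)

lemma monoid_hom_ruffle: "monoid_hom (ruffle_monoid n) (symmetric_group n) (ruffle n)"
  unfolding ruffle_eq_comp
  by (rule monoid_hom_comp[OF monoid_hom_orientedruffle monoid_hom_forget_orientation])

lemma monoid_hom_id: "monoid M \<Longrightarrow> monoid_hom M M id"
  by (simp add: monoid_hom_def hom_def)


section \<open>Products of hand classes\<close>

definition hand_class :: "nat \<Rightarrow> nat \<Rightarrow> (nat \<times> (nat \<Rightarrow> nat)) set"
  where "hand_class n a = {a} \<times> ({1..n} \<rightarrow>\<^sub>E {..<a})"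

lemma finite_hand_class: "finite (hand_class n a)"
  by (simp add: hand_class_def finite_PiE)

lemma card_hand_class: "card (hand_class n a) = a ^ n"
  by (simp add: hand_class_def card_PiE card_cartesian_product)

lemma hand_level: "1 \<le> a \<Longrightarrow> {p \<in> carrier (ruffle_monoid n). hand p = a} = hand_class n a"
  by (auto simp: hand_class_def hand_def ruffle_monoid_def)

lemma hand_image: "hand ` carrier (ruffle_monoid n) = {1..}"
proof (intro equalityI subsetI)
  fix a :: nat assume a: "a \<in> {1..}"
  then have "(a, \<lambda>i\<in>{1..n}. 0) \<in> carrier (ruffle_monoid n)"
    by (auto simp: mem_ruffle_monoid)
  then show "a \<in> hand ` carrier (ruffle_monoid n)"
    by (force simp: hand_def)
qed (auto simp: hand_def ruffle_monoid_def)

lemma hand_level_sets: "level_sets (ruffle_monoid n) hand = hand_class n ` {1..}"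
  unfolding level_sets_eq hand_image by (intro image_cong refl) (simp add: hand_level)

text \<open>The combined hands determine \<open>y\<close> by \<open>enc_inject\<close>, hence the
  permutation moving \<open>x\<close>, and then \<open>x\<close>. Surjectivity follows by counting,
  since \<open>a ^ n * b ^ n = (a * b) ^ n\<close>.\<close>

lemma bij_betw_ruffle_mult:
  assumes "1 \<le> a" "1 \<le> b"
  shows "bij_betw (\<lambda>(p, q). ruffle_mult n p q) (hand_class n a \<times> hand_class n b) (hand_class n (a * b))"
proof -
  let ?f = "\<lambda>(p, q). ruffle_mult n p q"
  have "inj_on ?f (hand_class n a \<times> hand_class n b)"
  proof (rule inj_onI, clarify)
    fix p q p' q'
    assume A: "p \<in> hand_class n a" "p' \<in> hand_class n a" "q \<in> hand_class n b" "q' \<in> hand_class n b"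
      and eq: "ruffle_mult n p q = ruffle_mult n p' q'"
    obtain x x' where p: "p = (a, x)" "p' = (a, x')" "x \<in> {1..n} \<rightarrow>\<^sub>E {..<a}" "x' \<in> {1..n} \<rightarrow>\<^sub>E {..<a}"
      using A by (auto simp: hand_class_def)
    obtain y y' where q: "q = (b, y)" "q' = (b, y')" "y \<in> {1..n} \<rightarrow>\<^sub>E {..<b}" "y' \<in> {1..n} \<rightarrow>\<^sub>E {..<b}"
      using A by (auto simp: hand_class_def)
    let ?s = "ruffle n (b, y)"
    have *: "act x ?s i = act x' (ruffle n (b, y')) i \<and> y i = y' i" if i: "i \<in> {1..n}" for i
    proof (rule enc_inject)
      show "y i < b" "y' i < b"
        using i q by (auto simp: PiE_iff simp del: atLeastAtMost_iff)
      have "(\<lambda>i\<in>{1..n}. enc b (act x ?s i) (y i)) i = (\<lambda>i\<in>{1..n}. enc b (act x' (ruffle n (b, y')) i) (y' i)) i"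
        using eq unfolding p(1,2) q(1,2) ruffle_mult_eq by (simp only: prod.inject)
      then show "enc b (act x ?s i) (y i) = enc b (act x' (ruffle n (b, y')) i) (y' i)"
        using i by simp
    qed
    then have y: "y = y'"
      using PiE_ext[OF q(3,4)] by blast
    have "x i = x' i" if i: "i \<in> {1..n}" for i
    proof -
      have "?s i \<in> {1..n}"
        using i permutes_in_image[OF ruffle_permutes] by blast
      then have "act x ?s (?s i) = act x' ?s (?s i)" using * y by blast
      then show ?thesis by (simp add: act_apply[OF ruffle_permutes])
    qed
    then have "x = x'"
      using PiE_ext[OF p(3,4)] by blast
    then show "p = p' \<and> q = q'" using y p q by simp
  qed
  moreover have "?f ` (hand_class n a \<times> hand_class n b) \<subseteq> hand_class n (a * b)"
    using ruffle_mult_closed[of _ n] assms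
    by (fastforce simp: hand_class_def ruffle_mult_eq mem_ruffle_monoid)
  moreover have "card (hand_class n a \<times> hand_class n b) = card (hand_class n (a * b))"
    by (simp add: card_cartesian_product card_hand_class power_mult_distrib)
  ultimately show ?thesis
    by (metis bij_betw_def card_image card_subset_eq finite_hand_class)
qed

section \<open>The commutative algebra spanned by the images of the hand classes\<close>

definition hand_image_sum ::
    "nat \<Rightarrow> (nat \<times> (nat \<Rightarrow> nat) \<Rightarrow> 'b) \<Rightarrow> nat \<Rightarrow> ('b \<Rightarrow>\<^sub>0 rat)"
  where "hand_image_sum n f a = (\<Sum>p\<in>hand_class n a. Poly_Mapping.single (f p) 1)"

lemma image_class_sums_hand:
  "image_class_sums (ruffle_monoid n) hand f = hand_image_sum n f ` {1..}"
  by (simp add: image_class_sums_def hand_level_sets image_image hand_image_sum_def)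

lemma hand_image_sum_mult:
  assumes f: "monoid_hom (ruffle_monoid n) N f" and ab: "1 \<le> a" "1 \<le> b"
  shows "malg_mult N (hand_image_sum n f a) (hand_image_sum n f b) = hand_image_sum n f (a * b)"
proof -
  have hom: "f p \<otimes>\<^bsub>N\<^esub> f q = f (ruffle_mult n p q)"
    if "p \<in> hand_class n a" "q \<in> hand_class n b" for p q
  proof -
    have "p \<in> carrier (ruffle_monoid n)" "q \<in> carrier (ruffle_monoid n)"
      using that ab hand_level by blast+
    then have "f (p \<otimes>\<^bsub>ruffle_monoid n\<^esub> q) = f p \<otimes>\<^bsub>N\<^esub> f q"
      using f by (simp add: monoid_hom_def hom_def)
    then show ?thesis by (simp add: ruffle_monoid_def)
  qed
  have "malg_mult N (hand_image_sum n f a) (hand_image_sum n f b) =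
      (\<Sum>p\<in>hand_class n a. \<Sum>q\<in>hand_class n b. Poly_Mapping.single (f (ruffle_mult n p q)) 1)"
    unfolding hand_image_sum_def malg_mult_sum_left unfolding malg_mult_sum_right malg_mult_single
    by (intro sum.cong refl) (simp add: hom)
  also have "\<dots> = (\<Sum>(p, q)\<in>hand_class n a \<times> hand_class n b. Poly_Mapping.single (f (ruffle_mult n p q)) 1)"
    by (rule sum.cartesian_product)
  also have "\<dots> = (\<Sum>r\<in>hand_class n (a * b). Poly_Mapping.single (f r) 1)"
    using sum.reindex_bij_betw[OF bij_betw_ruffle_mult[OF ab], of "\<lambda>r. Poly_Mapping.single (f r) (1::rat)" n]
    by (simp add: case_prod_unfold)
  finally show ?thesis by (simp add: hand_image_sum_def)
qed

lemma
  assumes f: "monoid_hom (ruffle_monoid n) N f"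
    and gh: "g \<in> malg.span (image_class_sums (ruffle_monoid n) hand f)"
      "h \<in> malg.span (image_class_sums (ruffle_monoid n) hand f)"
  shows hand_image_span_closed: "malg_mult N g h \<in> malg.span (image_class_sums (ruffle_monoid n) hand f)"
    and hand_image_span_commute: "malg_mult N g h = malg_mult N h g"
proof -
  have prod: "malg_mult N u v = malg_mult N v u \<and>
      malg_mult N u v \<in> malg.span (image_class_sums (ruffle_monoid n) hand f)"
    if mem: "u \<in> image_class_sums (ruffle_monoid n) hand f" "v \<in> image_class_sums (ruffle_monoid n) hand f" for u v
  proof -
    obtain a b where "a \<in> {1..}" "b \<in> {1..}" and uv: "u = hand_image_sum n f a" "v = hand_image_sum n f b"
      using mem unfolding image_class_sums_hand by blast
    then have ab: "1 \<le> a" "1 \<le> b" "1 \<le> a * b" by simp_all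
    then have "hand_image_sum n f (a * b) \<in> malg.span (image_class_sums (ruffle_monoid n) hand f)"
      unfolding image_class_sums_hand using ab by (intro malg.span_base imageI) simp
    then show ?thesis
      unfolding uv hand_image_sum_mult[OF f ab(1,2)] hand_image_sum_mult[OF f ab(2,1)]
      by (simp add: mult.commute)
  qed
  show "malg_mult N g h \<in> malg.span (image_class_sums (ruffle_monoid n) hand f)"
    using span_malg_mult_closed[OF _ gh] prod by blast
  show "malg_mult N g h = malg_mult N h g"
    using span_malg_mult_commute[OF _ gh] prod by blast
qed

lemma lumping_hand: "lumping (ruffle_monoid n) hand"
proof (rule lumpingI[OF monoid_ruffle_monoid])
  show "finite C" if "C \<in> level_sets (ruffle_monoid n) hand" for C
    using that by (auto simp: hand_level_sets finite_hand_class)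
  \<comment> \<open>The identity is a homomorphism too, so the closure result for images applies to
    the hand class sums themselves.\<close>
  have "image_class_sums (ruffle_monoid n) hand id = class_sums (ruffle_monoid n) hand"
    by (simp add: image_class_sums_def class_sums_def class_sum_def)
  then show "malg_mult (ruffle_monoid n) f g \<in> malg.span (class_sums (ruffle_monoid n) hand)"
    if "f \<in> malg.span (class_sums (ruffle_monoid n) hand)"
      "g \<in> malg.span (class_sums (ruffle_monoid n) hand)" for f g
    using hand_image_span_closed[OF monoid_hom_id[OF monoid_ruffle_monoid], of f n g] that by simp
qed

text \<open>Closure under products is inherited from the images of the hand classes; this serves the
  oriented and the symmetric group alike.\<close>

lemma lumping_if_span_eq:
  assumes "monoid_hom (ruffle_monoid n) N f" "finite (carrier N)"
    and "malg.span (image_class_sums (ruffle_monoid n) hand f) = malg.span (class_sums N \<nu>)"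
  shows "lumping N \<nu>"
proof (rule lumpingI)
  show "monoid N" using assms by (simp add: monoid_hom_def)
  show "finite C" if "C \<in> level_sets N \<nu>" for C
    using that assms by (auto simp: level_sets_def)
  show "malg_mult N g h \<in> malg.span (class_sums N \<nu>)"
    if "g \<in> malg.span (class_sums N \<nu>)" "h \<in> malg.span (class_sums N \<nu>)" for g h
    using hand_image_span_closed[OF assms(1)] that by (simp add: assms(3))
qed


section \<open>The oriented rising number\<close>

text \<open>The amount by which the hand at least increases between the cards \<open>k\<close> and \<open>k + 1\<close>.\<close>

definition gap :: "(int \<Rightarrow> int) \<Rightarrow> nat \<Rightarrow> nat"
  where "gap w k = (if w (int k) < 0 \<longleftrightarrow> w (int (Suc k)) < 0
    then if w (int k) < w (int (Suc k)) then 0 else 2 else 1)"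

text \<open>The sum includes the gap at \<open>0\<close>: a fictitious card \<open>0\<close> with
  \<open>w 0 = 0\<close> lies in hand \<open>0\<close>, so the first gap is 1 if card
  \<open>1\<close> is turned over and 0 otherwise.\<close>

definition min_hand :: "(int \<Rightarrow> int) \<Rightarrow> nat \<Rightarrow> nat"
  where "min_hand w k = (\<Sum>j<k. gap w j)"

lemma min_hand_Suc: "min_hand w (Suc k) = min_hand w k + gap w k"
  by (simp add: min_hand_def)

text \<open>A gap is odd exactly where the orientation changes, and the fictitious card
  \<open>0\<close> counts as not turned over.\<close>

lemma even_min_hand: "w 0 = 0 \<Longrightarrow> even (min_hand w k) \<longleftrightarrow> \<not> w (int k) < 0"
proof (induction k)
  case 0
  then show ?case by (simp add: min_hand_def)
next
  case (Suc k)
  then show ?case by (auto simp: min_hand_Suc gap_def)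
qed

lemma min_hand_mono: "k \<le> l \<Longrightarrow> min_hand w k \<le> min_hand w l"
  by (induction l rule: dec_induct) (auto simp: min_hand_Suc)

lemma min_hand_eq_imp_less:
  assumes "k < l" "min_hand w k = min_hand w l"
  shows "w (int k) < w (int l)"
  using assms
proof (induction l)
  case (Suc l)
  have le: "min_hand w k \<le> min_hand w l"
    using Suc by (intro min_hand_mono) simp
  then have "gap w l = 0" "min_hand w k = min_hand w l"
    using Suc by (simp_all add: min_hand_Suc)
  then have step: "w (int l) < w (int (Suc l))"
    by (auto simp: gap_def split: if_splits)
  show ?case
  proof (cases "k = l")
    case False
    then have "w (int k) < w (int l)"
      using Suc \<open>min_hand w k = min_hand w l\<close> by simp
    then show ?thesis using step by simp
  qed (use step in simp)
qed simp

lemma feeds_iff_min_hand: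
  assumes w: "w \<in> carrier (oriented_group n)"
  shows "feeds n x w \<longleftrightarrow>
    (\<exists>e. mono_on {1..n} e \<and> (\<forall>k\<in>{1..n}. x (forget_orientation w k) = min_hand w k + 2 * e k))"
proof
  note w0 = oriented_zero[OF w]
  have nonzero: "w (int k) \<noteq> 0" if "k \<in> {1..n}" for k
    using oriented_in_range[OF w that] by auto
  assume F: "feeds n x w"
  define y where "y k = (if k = 0 then 0 else x (forget_orientation w k))" for k
  have even_y: "even (y k) \<longleftrightarrow> \<not> w (int k) < 0" if "k \<le> n" for k
  proof (cases "k = 0")
    case False
    then have k: "k \<in> {1..n}" using that by simp
    then have "even (x (forget_orientation w k)) \<longleftrightarrow> 0 < w (int k)"
      using F unfolding feeds_def by blast
    then show ?thesis using nonzero[OF k] False by (auto simp: y_def)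
  qed (simp add: y_def w0)
  have step: "y k + gap w k \<le> y (Suc k)" if k: "k < n" for k
  proof -
    \<comment> \<open>For \<open>k = 0\<close> this is not part of \<open>feeds\<close>: a first
      hand \<open>0\<close> is even, which forces \<open>w 1\<close> to be positive.\<close>
    have weak: "y k < y (Suc k) \<or> y k = y (Suc k) \<and> w (int k) < w (int (Suc k))"
    proof (cases "k = 0")
      case True
      then have "0 < w (int (Suc k))" if "y (Suc k) = 0"
        using even_y[of "Suc k"] nonzero[of "Suc k"] k that by auto
      then show ?thesis using True by (auto simp: y_def w0)
    next
      case False
      then have "k \<in> {1..n}" "Suc k \<in> {1..n}" "k < Suc k" using k by auto
      then have "x (forget_orientation w k) < x (forget_orientation w (Suc k)) \<or>
          x (forget_orientation w k) = x (forget_orientation w (Suc k)) \<and> w (int k) < w (int (Suc k))"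
        using F unfolding feeds_def by blast
      then show ?thesis using False by (simp add: y_def)
    qed
    have parity: "even (y k) \<longleftrightarrow> \<not> w (int k) < 0" "even (y (Suc k)) \<longleftrightarrow> \<not> w (int (Suc k)) < 0"
      using even_y k by auto
    show ?thesis
    \<comment> \<open>Equal orientations mean equal parity, so the hand either stays, which needs an
      ascent, or rises by at least 2; different orientations force a rise of at least 1.\<close>
    proof (cases "w (int k) < 0 \<longleftrightarrow> w (int (Suc k)) < 0")
      case True
      then have "even (y k) \<longleftrightarrow> even (y (Suc k))" using parity by simp
      then have "y (Suc k) \<noteq> Suc (y k)" by auto
      then show ?thesis using weak True by (auto simp: gap_def)
    next
      case False
      then have "y k \<noteq> y (Suc k)" using parity by metis
      then show ?thesis using weak False by (auto simp: gap_def)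
    qed
  qed
  \<comment> \<open>Adding up the steps: \<open>y - min_hand w\<close> is weakly increasing, stated
    without subtraction.\<close>
  have incr: "y k + min_hand w l \<le> y l + min_hand w k" if "k \<le> l" "l \<le> n" for k l
    using that
  proof (induction l rule: dec_induct)
    case (step m)
    then show ?case using \<open>\<And>k. k < n \<Longrightarrow> y k + gap w k \<le> y (Suc k)\<close>[of m]
      by (simp add: min_hand_Suc)
  qed simp
  have ge: "min_hand w k \<le> y k" if "k \<le> n" for k
    using incr[of 0 k] that by (simp add: y_def min_hand_def)
  have y_eq: "y k = min_hand w k + 2 * ((y k - min_hand w k) div 2)" if "k \<le> n" for k
    using ge[OF that] even_y[OF that] even_min_hand[of w k, OF w0] by auto
  show "\<exists>e. mono_on {1..n} e \<and> (\<forall>k\<in>{1..n}. x (forget_orientation w k) = min_hand w k + 2 * e k)"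
  proof (intro exI conjI ballI)
    show "mono_on {1..n} (\<lambda>k. (y k - min_hand w k) div 2)"
    proof (rule mono_onI)
      fix k l assume "k \<in> {1..n}" "l \<in> {1..n}" "k \<le> l"
      then show "(y k - min_hand w k) div 2 \<le> (y l - min_hand w l) div 2"
        using incr[of k l] by (intro div_le_mono) auto
    qed
    fix k assume "k \<in> {1..n}"
    then show "x (forget_orientation w k) = min_hand w k + 2 * ((y k - min_hand w k) div 2)"
      using y_eq[of k] by (simp add: y_def)
  qed
next
  assume "\<exists>e. mono_on {1..n} e \<and> (\<forall>k\<in>{1..n}. x (forget_orientation w k) = min_hand w k + 2 * e k)"
  then obtain e where e: "mono_on {1..n} e"
    and x: "\<And>k. k \<in> {1..n} \<Longrightarrow> x (forget_orientation w k) = min_hand w k + 2 * e k" by blast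
  have "x (forget_orientation w k) < x (forget_orientation w l) \<or>
      x (forget_orientation w k) = x (forget_orientation w l) \<and> w (int k) < w (int l)"
    if kl: "k \<in> {1..n}" "l \<in> {1..n}" "k < l" for k l
  proof -
    have "e k \<le> e l" using mono_onD[OF e, of k l] kl by simp
    moreover have "min_hand w k \<le> min_hand w l" using kl by (simp add: min_hand_mono)
    ultimately show ?thesis
      using min_hand_eq_imp_less[OF kl(3), of w] by (fastforce simp: x[OF kl(1)] x[OF kl(2)])
  qed
  moreover have "even (x (forget_orientation w k)) \<longleftrightarrow> 0 < w (int k)" if k: "k \<in> {1..n}" for k
    using even_min_hand[of w k, OF oriented_zero[OF w]] oriented_in_range[OF w k] by (auto simp: x[OF k])
  ultimately show "feeds n x w"
    using w unfolding feeds_def by blast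
qed

text \<open>The sequences \<open>e\<close> in \<open>min_hand w k + 2 * e k\<close>. For
  \<open>r = min_hand w n + 1\<close> the bound says that the last, hence highest, hand is below
  \<open>a\<close>. Extensionality gives each sequence a single representative.\<close>

definition excess_sequences :: "nat \<Rightarrow> nat \<Rightarrow> nat \<Rightarrow> (nat \<Rightarrow> nat) set"
  where "excess_sequences n a r = {e \<in> {1..n} \<rightarrow>\<^sub>E UNIV. mono_on {1..n} e \<and> r + 2 * e n \<le> a}"

lemma excess_sequences_empty: "a < r \<Longrightarrow> excess_sequences n a r = {}"
  by (auto simp: excess_sequences_def)

lemma excess_sequences_same:
  assumes "1 \<le> n"
  shows "excess_sequences n r r = {\<lambda>i\<in>{1..n}. 0}"
proof (intro equalityI subsetI)
  fix e assume e: "e \<in> excess_sequences n r r"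
  have "e i = 0" if "i \<in> {1..n}" for i
    using mono_onD[of "{1..n}" e i n] e that assms by (simp add: excess_sequences_def)
  then show "e \<in> {\<lambda>i\<in>{1..n}. 0}"
    using e by (auto simp: excess_sequences_def PiE_iff extensional_def fun_eq_iff)
qed (use assms in \<open>auto simp: excess_sequences_def mono_on_def\<close>)

text \<open>By \<open>feeds_iff_min_hand\<close> the hands of the cards determine \<open>e\<close>;
  the map passes from cards to final positions. Bounding the hand of card \<open>n\<close> suffices,
  as \<open>min_hand w\<close> and \<open>e\<close> both increase.\<close>

lemma bij_betw_excess_sequences:
  assumes n: "1 \<le> n" and w: "w \<in> carrier (oriented_group n)"
  shows "bij_betw
    (\<lambda>e. (a, \<lambda>i\<in>{1..n}. let k = inv_into UNIV (forget_orientation w) i in min_hand w k + 2 * e k))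
    (excess_sequences n a (Suc (min_hand w n)))
    {p \<in> carrier (ruffle_monoid n). hand p = a \<and> orientedruffle n p = w}"
    (is "bij_betw ?f ?E ?X")
proof -
  let ?s = "forget_orientation w"
  note perm = forget_permutes[OF w]
  have snd_f: "snd (?f e) (?s k) = min_hand w k + 2 * e k" if "k \<in> {1..n}" for e k
    using forget_in_range[OF w that] by (simp add: permutes_inverses(2)[OF perm] Let_def)
  have "inj_on ?f ?E"
  proof (rule inj_onI)
    fix e e' assume E: "e \<in> ?E" "e' \<in> ?E" "?f e = ?f e'"
    have "e k = e' k" if k: "k \<in> {1..n}" for k
    proof -
      have "snd (?f e) (?s k) = snd (?f e') (?s k)"
        unfolding E(3) ..
      then show ?thesis
        unfolding snd_f[OF k] by simp
    qed
    then show "e = e'"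
      using E(1,2) by (auto simp: excess_sequences_def intro!: PiE_ext[of e "{1..n}" "\<lambda>_. UNIV"])
  qed
  moreover have "?f e \<in> ?X" if e: "e \<in> ?E" for e
  proof -
    have mono: "mono_on {1..n} e" and bound: "min_hand w n + 2 * e n < a"
      using e by (auto simp: excess_sequences_def)
    have "snd (?f e) i < a" if i: "i \<in> {1..n}" for i
    proof -
      let ?k = "inv_into UNIV ?s i"
      have k: "?k \<in> {1..n}" using inv_permutes_in_range[OF perm i] .
      then have "e ?k \<le> e n" "min_hand w ?k \<le> min_hand w n"
        using mono_onD[OF mono, of ?k n] n by (simp_all add: min_hand_mono)
      then show ?thesis using bound i by (simp add: Let_def)
    qed
    then have "?f e \<in> carrier (ruffle_monoid n)"
      using bound by (auto simp: mem_ruffle_monoid PiE_iff)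
    moreover have "feeds n (snd (?f e)) w"
      unfolding feeds_iff_min_hand[OF w] using mono snd_f by blast
    then have "orientedruffle n (?f e) = w"
      using eq_orientedruffle_iff[of w n a "snd (?f e)"] by simp
    ultimately show ?thesis by (simp add: hand_def)
  qed
  moreover have "p \<in> ?f ` ?E" if p: "p \<in> ?X" for p
  proof -
    obtain x where x: "p = (a, x)" "x \<in> {1..n} \<rightarrow>\<^sub>E {..<a}" "feeds n x w"
      using p by (cases p) (auto simp: hand_def mem_ruffle_monoid feeds_orientedruffle)
    then obtain e where mono: "mono_on {1..n} e"
      and e: "\<And>k. k \<in> {1..n} \<Longrightarrow> x (?s k) = min_hand w k + 2 * e k"
      unfolding feeds_iff_min_hand[OF w] by blast
    let ?e = "restrict e {1..n}"
    have "x (?s n) < a"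
      using x(2) forget_in_range[OF w, of n] n by (auto simp: PiE_iff)
    then have "?e \<in> ?E"
      using mono e[of n] n by (auto simp: excess_sequences_def mono_on_def)
    moreover have "?f ?e = p"
    proof -
      have "(\<lambda>i\<in>{1..n}. let k = inv_into UNIV ?s i in min_hand w k + 2 * ?e k) = restrict x {1..n}"
      proof (rule restrict_ext)
        fix i assume i: "i \<in> {1..n}"
        have "inv_into UNIV ?s i \<in> {1..n}" using inv_permutes_in_range[OF perm i] .
        then show "(let k = inv_into UNIV ?s i in min_hand w k + 2 * ?e k) = x i"
          using e[of "inv_into UNIV ?s i"] by (simp add: permutes_inverses(1)[OF perm] Let_def)
      qed
      then show ?thesis using x by (simp add: PiE_restrict)
    qed
    ultimately show ?thesis by blast
  qed
  ultimately show ?thesis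
    unfolding bij_betw_def by blast
qed

text \<open>Ruffles with \<open>a\<close> hands that give \<open>w\<close> exist iff there are
  excess sequences for \<open>a\<close>. The zero sequence is available as soon as \<open>a\<close>
  exceeds \<open>min_hand w n\<close>.\<close>

lemma oriented_rising_number_eq:
  assumes n: "1 \<le> n" and w: "w \<in> carrier (oriented_group n)"
  shows "oriented_rising_number n w = Suc (min_hand w n)"
proof -
  have "(\<exists>x. (a, x) \<in> carrier (ruffle_monoid n) \<and> w = orientedruffle n (a, x)) \<longleftrightarrow>
      Suc (min_hand w n) \<le> a" for a
  proof -
    have "(\<exists>x. (a, x) \<in> carrier (ruffle_monoid n) \<and> w = orientedruffle n (a, x)) \<longleftrightarrow>
        {p \<in> carrier (ruffle_monoid n). hand p = a \<and> orientedruffle n p = w} \<noteq> {}"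
      by (auto simp: hand_def)
    also have "\<dots> \<longleftrightarrow> excess_sequences n a (Suc (min_hand w n)) \<noteq> {}"
      unfolding bij_betw_imp_surj_on[OF bij_betw_excess_sequences[OF assms, of a], symmetric]
      by (simp only: image_is_empty)
    also have "\<dots> \<longleftrightarrow> Suc (min_hand w n) \<le> a"
    proof
      assume "Suc (min_hand w n) \<le> a"
      then have "(\<lambda>i\<in>{1..n}. 0) \<in> excess_sequences n a (Suc (min_hand w n))"
        using n by (auto simp: excess_sequences_def mono_on_def)
      then show "excess_sequences n a (Suc (min_hand w n)) \<noteq> {}" by blast
    qed (auto simp: excess_sequences_def)
    finally show ?thesis .
  qed
  then show ?thesis
    unfolding oriented_rising_number_def by (simp add: Least_equality)
qed

lemma span_orientedruffle_hand:
  assumes n: "1 \<le> n"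
  shows "malg.span (image_class_sums (ruffle_monoid n) hand (orientedruffle n)) =
    malg.span (class_sums (oriented_group n) (oriented_rising_number n))"
proof (rule span_image_class_sums_triangular[where c = "\<lambda>a r. card (excess_sequences n a r)"])
  show "finite C" if "C \<in> level_sets (ruffle_monoid n) hand" for C
    using that by (auto simp: hand_level_sets finite_hand_class)
  show "orientedruffle n p \<in> carrier (oriented_group n)" for p
    by (cases p) (simp add: orientedruffle_in_oriented_group)
  show "card {p \<in> carrier (ruffle_monoid n). hand p = a \<and> orientedruffle n p = w} =
      card (excess_sequences n a (oriented_rising_number n w))"
    if "w \<in> carrier (oriented_group n)" for a w
    using bij_betw_same_card[OF bij_betw_excess_sequences[OF n that, of a]]
    by (simp add: oriented_rising_number_eq[OF n that])
qed (use finite_oriented_group in \<open>simp_all add: excess_sequences_empty excess_sequences_same[OF n]\<close>)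


section \<open>Turning points and orientations\<close>

definition signed_perm :: "nat \<Rightarrow> (nat \<Rightarrow> nat) \<Rightarrow> nat set \<Rightarrow> int \<Rightarrow> int"
  where "signed_perm n \<sigma> E i = (if i \<in> signed_range n
    then sgn i * (if nat \<bar>i\<bar> \<in> E then -1 else 1) * int (\<sigma> (nat \<bar>i\<bar>)) else i)"

lemma signed_perm:
  assumes \<sigma>: "\<sigma> permutes {1..n}"
  shows signed_perm_in_oriented_group: "signed_perm n \<sigma> E \<in> carrier (oriented_group n)"
    and forget_signed_perm: "forget_orientation (signed_perm n \<sigma> E) = \<sigma>"
    and signed_perm_neg: "k \<in> {1..n} \<Longrightarrow> signed_perm n \<sigma> E (int k) < 0 \<longleftrightarrow> k \<in> E"
proof -
  have \<sigma>_range: "\<sigma> k \<in> {1..n}" if "k \<in> {1..n}" for k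
    using permutes_in_image[OF \<sigma>] that by blast
  have odd: "signed_perm n \<sigma> E (- i) = - signed_perm n \<sigma> E i" for i
    by (simp add: signed_perm_def sgn_minus)
  have "signed_perm n \<sigma> E permutes signed_range n"
    using permutes_inj_on[OF \<sigma>] \<sigma>_range odd
  proof (rule signed_extension_permutes)
    fix i assume "i \<in> signed_range n"
    then show "\<bar>signed_perm n \<sigma> E i\<bar> = int (\<sigma> (nat \<bar>i\<bar>))"
      by (auto simp: signed_perm_def abs_mult abs_sgn_eq)
  qed (auto simp: signed_perm_def)
  then show "signed_perm n \<sigma> E \<in> carrier (oriented_group n)"
    using odd by (simp add: mem_oriented_group)
  show "forget_orientation (signed_perm n \<sigma> E) = \<sigma>"
  proof
    fix k
    show "forget_orientation (signed_perm n \<sigma> E) k = \<sigma> k"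
    proof (cases "k \<in> {1..n}")
      case False
      then show ?thesis
        using permutes_not_in[OF \<sigma> False] by (auto simp: forget_orientation_def signed_perm_def)
    qed (auto simp: forget_orientation_def signed_perm_def)
  qed
  show "signed_perm n \<sigma> E (int k) < 0 \<longleftrightarrow> k \<in> E" if "k \<in> {1..n}"
    using that \<sigma>_range[OF that] by (auto simp: signed_perm_def)
qed

text \<open>
  The gap between \<open>k\<close> and \<open>k + 1\<close> counts those of the two cards whose orientation disagrees with
  the direction of the step from \<open>\<sigma> k\<close> to \<open>\<sigma> (k + 1)\<close>. Here the orientation of \<open>k\<close> is compared
  with the step leading to \<open>k\<close>; the step leaving \<open>k\<close> has the other direction iff \<open>k\<close> is a turning
  point.
\<close>

definition mismatches :: "nat \<Rightarrow> (int \<Rightarrow> int) \<Rightarrow> nat set"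
  where "mismatches n w =
    {k \<in> {1..n}. (w (int k) < 0) \<noteq> (forget_orientation w k < forget_orientation w (k - 1))}"

text \<open>Over a fixed \<open>\<sigma>\<close> the directions of the steps are fixed, so sign
  patterns and mismatch sets determine each other by an exclusive or, and every pattern
  occurs.\<close>

lemma bij_betw_mismatches:
  assumes \<sigma>: "\<sigma> permutes {1..n}"
  shows "bij_betw (mismatches n) {w \<in> carrier (oriented_group n). forget_orientation w = \<sigma>} (Pow {1..n})"
    (is "bij_betw _ ?F _")
proof -
  have "inj_on (mismatches n) ?F"
  proof (rule inj_onI)
    fix v w assume vw: "v \<in> ?F" "w \<in> ?F" "mismatches n v = mismatches n w"
    show "v = w"
    proof (rule oriented_eqI)
      fix k assume k: "k \<in> {1..n}"
      have "k \<in> mismatches n v \<longleftrightarrow> k \<in> mismatches n w" using vw by simp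
      then have "v (int k) < 0 \<longleftrightarrow> w (int k) < 0"
        using vw k by (auto simp: mismatches_def)
      moreover have "v (int k) \<noteq> 0" "w (int k) \<noteq> 0"
        using oriented_in_range[of v n k] oriented_in_range[of w n k] vw k by auto
      ultimately have "0 < v (int k) \<longleftrightarrow> 0 < w (int k)" by auto
      then show "v (int k) = w (int k)"
        using oriented_eq_forget[of v n k] oriented_eq_forget[of w n k] vw k by auto
    qed (use vw in auto)
  qed
  moreover have "M \<in> mismatches n ` ?F" if M: "M \<in> Pow {1..n}" for M
  proof -
    let ?w = "signed_perm n \<sigma> {k. (k \<in> M) \<noteq> (\<sigma> k < \<sigma> (k - 1))}"
    have "mismatches n ?w = M"
      using M signed_perm_neg[OF \<sigma>]
      unfolding mismatches_def forget_signed_perm[OF \<sigma>] by blast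
    moreover have "?w \<in> ?F"
      using signed_perm_in_oriented_group[OF \<sigma>] forget_signed_perm[OF \<sigma>] by blast
    ultimately show ?thesis by blast
  qed
  moreover have "mismatches n ` ?F \<subseteq> Pow {1..n}"
    by (auto simp: mismatches_def)
  ultimately show ?thesis
    unfolding bij_betw_def by blast
qed

section \<open>Counting the orientations of a permutation by its turning points\<close>

definition turning_points :: "nat \<Rightarrow> (nat \<Rightarrow> nat) \<Rightarrow> nat set"
  where "turning_points n \<sigma> = {i. turning_point n \<sigma> i}"

lemma turning_points_subset: "turning_points n \<sigma> \<subseteq> {1..<n}"
  by (auto simp: turning_points_def turning_point_def)

text \<open>All gaps together compare each orientation with the step entering \<open>k\<close>,
  giving \<open>M\<close>, and with the step leaving \<open>k\<close>, giving \<open>B\<close>. A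
  turning point lies in exactly one of the two sets, any other \<open>k < n\<close> in both or
  neither; \<open>n\<close> has no leaving step inside the range.\<close>

lemma min_hand_eq_mismatches:
  assumes n: "1 \<le> n" and w: "w \<in> carrier (oriented_group n)"
  defines "T \<equiv> turning_points n (forget_orientation w)" and "M \<equiv> mismatches n w"
  shows "min_hand w n = card T + 2 * card (M \<inter> ({1..<n} - T)) + of_bool (n \<in> M)"
proof -
  let ?s = "forget_orientation w"
  define D where "D k \<longleftrightarrow> ?s k < ?s (k - 1)" for k
  define B where "B = {k \<in> {1..<n}. (w (int k) < 0) \<noteq> D (Suc k)}"
  have s0: "?s 0 = 0" and w0: "w 0 = 0"
    using oriented_zero[OF w] by (simp_all add: forget_orientation_def)
  have s_inj: "?s i = ?s j \<longleftrightarrow> i = j" for i j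
    using permutes_inj[OF forget_permutes[OF w]] by (auto dest: injD)
  have w_eq: "w (int k) = (if w (int k) < 0 then - int (?s k) else int (?s k))" for k
    by (simp add: forget_orientation_def)
  have gap: "gap w k = of_bool ((w (int k) < 0) \<noteq> D (Suc k)) + of_bool ((w (int (Suc k)) < 0) \<noteq> D (Suc k))" for k
  proof -
    have "?s k < ?s (Suc k) \<longleftrightarrow> \<not> D (Suc k)"
      using s_inj[of k "Suc k"] by (auto simp: D_def)
    then show ?thesis
      using w_eq[of k] w_eq[of "Suc k"] by (auto simp: gap_def D_def split: if_splits)
  qed
  \<comment> \<open>The term at \<open>0\<close> vanishes: the step leaving \<open>0\<close>
    ascends, and \<open>w 0\<close> is not negative.\<close>
  have "\<not> D (Suc 0)" by (simp add: D_def s0)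
  then have "(\<Sum>k<n. of_bool ((w (int k) < 0) \<noteq> D (Suc k))) = (\<Sum>k\<in>{1..<n}. of_bool ((w (int k) < 0) \<noteq> D (Suc k)) :: nat)"
    by (intro sum.mono_neutral_right) (auto simp: w0 Suc_le_eq)
  also have "\<dots> = card B"
    by (simp add: B_def sum_of_bool_eq Int_def)
  finally have sum_B: "(\<Sum>k<n. of_bool ((w (int k) < 0) \<noteq> D (Suc k))) = card B" .
  have "(\<Sum>k<n. of_bool ((w (int (Suc k)) < 0) \<noteq> D (Suc k))) = (\<Sum>k\<in>{1..n}. of_bool ((w (int k) < 0) \<noteq> D k) :: nat)"
    by (rule sum.reindex_bij_witness[where i = "\<lambda>k. k - 1" and j = Suc]) auto
  also have "\<dots> = card M"
    by (simp add: M_def mismatches_def D_def sum_of_bool_eq Int_def)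
  finally have "min_hand w n = card B + card M"
    using sum_B by (simp add: min_hand_def gap sum.distrib)
  have turning: "k \<in> T \<longleftrightarrow> D k \<noteq> D (Suc k)" if "k \<in> {1..<n}" for k
  proof -
    have "?s (k - 1) \<noteq> ?s k" "?s k \<noteq> ?s (k + 1)"
      using that by (auto simp: s_inj)
    then show ?thesis
      using that by (auto simp: T_def turning_points_def turning_point_def D_def)
  qed
  have T: "T \<subseteq> {1..<n}"
    unfolding T_def by (rule turning_points_subset)
  have M: "M \<subseteq> {1..n}" and mem_M: "\<And>k. k \<in> {1..n} \<Longrightarrow> k \<in> M \<longleftrightarrow> (w (int k) < 0) \<noteq> D k"
    by (auto simp: M_def mismatches_def D_def)
  have finite: "finite T" "finite M"
    using T M by (auto intro: finite_subset)
  have "k \<in> B \<longleftrightarrow> (k \<in> M) \<noteq> (k \<in> T)" if "k \<in> {1..<n}" for k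
    using that mem_M[of k] turning[OF that] by (auto simp: B_def)
  moreover have "B \<subseteq> {1..<n}"
    by (auto simp: B_def)
  ultimately have "B = (M \<inter> ({1..<n} - T)) \<union> (T - M)"
    using T by blast
  then have "card B = card (M \<inter> ({1..<n} - T)) + card (T - M)"
    using finite by (simp only:) (rule card_Un_disjoint, auto)
  moreover have "card T = card (T - M) + card (T \<inter> M)"
    using finite by (metis card_Diff_subset_Int card_mono finite_Int inf.cobounded1 le_add_diff_inverse2)
  moreover have "card M = card (M \<inter> ({1..<n} - T)) + card (T \<inter> M) + of_bool (n \<in> M)"
  proof -
    have "M = ((M \<inter> ({1..<n} - T)) \<union> (T \<inter> M)) \<union> (M \<inter> {n})"
      using M T by auto
    moreover have "card (((M \<inter> ({1..<n} - T)) \<union> (T \<inter> M)) \<union> (M \<inter> {n})) =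
        card ((M \<inter> ({1..<n} - T)) \<union> (T \<inter> M)) + card (M \<inter> {n})"
      using finite T by (intro card_Un_disjoint) auto
    moreover have "card ((M \<inter> ({1..<n} - T)) \<union> (T \<inter> M)) = card (M \<inter> ({1..<n} - T)) + card (T \<inter> M)"
      using finite by (intro card_Un_disjoint) auto
    moreover have "card (M \<inter> {n}) = of_bool (n \<in> M)" by simp
    ultimately show ?thesis by metis
  qed
  ultimately show ?thesis
    using \<open>min_hand w n = card B + card M\<close> by simp
qed

text \<open>\<open>M\<close> is free on \<open>T\<close>, which gives the power of 2. The parity of
  \<open>m - card T\<close> decides whether \<open>n\<close> belongs to \<open>M\<close>, and half
  of the rest is the number of elements taken among the \<open>n - 1 - card T\<close>
  others.\<close>

lemma card_subsets_weight:
  fixes m :: nat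
  assumes n: "1 \<le> n" and T: "T \<subseteq> {1..<n}"
  shows "card {M. M \<subseteq> {1..n} \<and> card T + 2 * card (M \<inter> ({1..<n} - T)) + of_bool (n \<in> M) = m} =
    (if card T \<le> m then 2 ^ card T * (n - 1 - card T choose ((m - card T) div 2)) else 0)"
proof (cases "card T \<le> m")
  case True
  let ?N = "{1..<n} - T" and ?q = "(m - card T) div 2"
  let ?R = "if odd (m - card T) then {n} else {}"
  let ?S = "{M. M \<subseteq> {1..n} \<and> card T + 2 * card (M \<inter> ?N) + of_bool (n \<in> M) = m}"
  have fin: "finite T" using T by (rule finite_subset) simp
  have "bij_betw (\<lambda>(P, Q). P \<union> Q \<union> ?R) (Pow T \<times> {Q. Q \<subseteq> ?N \<and> card Q = ?q}) ?S"
  proof (rule bij_betw_byWitness[where f' = "\<lambda>M. (M \<inter> T, M \<inter> ?N)"])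
    show "\<forall>PQ\<in>Pow T \<times> {Q. Q \<subseteq> ?N \<and> card Q = ?q}.
        (\<lambda>M. (M \<inter> T, M \<inter> ?N)) ((\<lambda>(P, Q). P \<union> Q \<union> ?R) PQ) = PQ"
      using T by auto
    have parity: "n \<in> M \<longleftrightarrow> odd (m - card T)" "card (M \<inter> ?N) = ?q" if "M \<in> ?S" for M
      using that by (auto split: if_splits simp: of_bool_def)
    have "M \<inter> T \<union> M \<inter> ?N \<union> ?R = M" if M: "M \<in> ?S" for M
    proof -
      have "M \<subseteq> insert n {1..<n}" using M by auto
      moreover have "M \<inter> {n} = ?R" using parity(1)[OF M] by simp
      ultimately show ?thesis by blast
    qed
    then show "\<forall>M\<in>?S. (\<lambda>(P, Q). P \<union> Q \<union> ?R) ((\<lambda>M. (M \<inter> T, M \<inter> ?N)) M) = M"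
      unfolding prod.case by blast
    show "(\<lambda>M. (M \<inter> T, M \<inter> ?N)) ` ?S \<subseteq> Pow T \<times> {Q. Q \<subseteq> ?N \<and> card Q = ?q}"
      using parity by auto
    have mem: "P \<union> Q \<union> ?R \<in> ?S" if PQ: "P \<subseteq> T" "Q \<subseteq> ?N" "card Q = ?q" for P Q
    proof -
      have "(P \<union> Q \<union> ?R) \<inter> ?N = Q" "n \<in> P \<union> Q \<union> ?R \<longleftrightarrow> odd (m - card T)" "P \<union> Q \<union> ?R \<subseteq> {1..n}"
        using PQ T n by auto
      moreover have "card T + 2 * ?q + of_bool (odd (m - card T)) = m"
        using True by (auto simp: of_bool_def) presburger+
      ultimately show ?thesis by (simp only: mem_Collect_eq PQ(3) simp_thms)
    qed
    show "(\<lambda>(P, Q). P \<union> Q \<union> ?R) ` (Pow T \<times> {Q. Q \<subseteq> ?N \<and> card Q = ?q}) \<subseteq> ?S"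
    proof (rule image_subsetI)
      fix PQ assume "PQ \<in> Pow T \<times> {Q. Q \<subseteq> ?N \<and> card Q = ?q}"
      then obtain P Q where "PQ = (P, Q)" "P \<subseteq> T" "Q \<subseteq> ?N" "card Q = ?q" by blast
      then show "(\<lambda>(P, Q). P \<union> Q \<union> ?R) PQ \<in> ?S"
        using mem by (simp only: prod.case)
    qed
  qed
  then have "card ?S = card (Pow T) * card {Q. Q \<subseteq> ?N \<and> card Q = ?q}"
    by (simp add: card_cartesian_product flip: bij_betw_same_card)
  also have "\<dots> = 2 ^ card T * (card ?N choose ?q)"
    using fin by (simp add: card_Pow n_subsets)
  also have "card ?N = n - 1 - card T"
    using T fin by (simp add: card_Diff_subset)
  finally show ?thesis using True by simp
next
  case False
  then have "{M. M \<subseteq> {1..n} \<and> card T + 2 * card (M \<inter> ({1..<n} - T)) + of_bool (n \<in> M) = m} = {}"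
    by auto
  then show ?thesis using False by simp
qed

lemma span_forget_orientation:
  assumes n: "1 \<le> n"
  shows "malg.span (image_class_sums (oriented_group n) (oriented_rising_number n) forget_orientation) =
    malg.span (class_sums (symmetric_group n) (turning_number n))"
proof -
  \<comment> \<open>Here \<open>a\<close> is the rising number and \<open>b\<close> the turning
    number plus 1, the least rising number of an orientation. This shift puts the nonzero entries
    \<open>2 ^ (b - 1)\<close> on the diagonal and leaves the level sets unchanged.\<close>
  let ?c = "\<lambda>a b. if b \<le> a then 2 ^ (b - 1) * (n - b choose ((a - b) div 2)) else 0"
  have "malg.span (image_class_sums (oriented_group n) (oriented_rising_number n) forget_orientation) =
    malg.span (class_sums (symmetric_group n) (\<lambda>\<sigma>. Suc (turning_number n \<sigma>)))"
  proof (rule span_image_class_sums_triangular[where c = ?c])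
    show "finite C" if "C \<in> level_sets (oriented_group n) (oriented_rising_number n)" for C
      using that finite_oriented_group[of n] by (auto simp: level_sets_def)
    show "forget_orientation w \<in> carrier (symmetric_group n)" if "w \<in> carrier (oriented_group n)" for w
      using forget_permutes[OF that] by (simp add: symmetric_group_def)
    fix a \<sigma> assume "\<sigma> \<in> carrier (symmetric_group n)"
    then have \<sigma>: "\<sigma> permutes {1..n}" by (simp add: symmetric_group_def)
    let ?T = "turning_points n \<sigma>"
    let ?W = "\<lambda>M. card ?T + 2 * card (M \<inter> ({1..<n} - ?T)) + of_bool (n \<in> M)"
    let ?F = "{w \<in> carrier (oriented_group n). forget_orientation w = \<sigma>}"
    have bij: "bij_betw (mismatches n) {w \<in> ?F. Suc (?W (mismatches n w)) = a} {M \<in> Pow {1..n}. Suc (?W M) = a}"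
      by (intro bij_betw_Collect bij_betw_mismatches \<sigma>) simp
    have eq: "{w \<in> ?F. Suc (?W (mismatches n w)) = a} =
        {w \<in> carrier (oriented_group n). oriented_rising_number n w = a \<and> forget_orientation w = \<sigma>}"
      using min_hand_eq_mismatches[OF n] oriented_rising_number_eq[OF n] by auto
    have "card {w \<in> carrier (oriented_group n). oriented_rising_number n w = a \<and> forget_orientation w = \<sigma>} =
        card {M \<in> Pow {1..n}. Suc (?W M) = a}"
      unfolding eq[symmetric] by (rule bij_betw_same_card[OF bij])
    also have "\<dots> = ?c a (Suc (turning_number n \<sigma>))"
    proof (cases a)
      case (Suc m)
      have "{M \<in> Pow {1..n}. Suc (?W M) = a} = {M. M \<subseteq> {1..n} \<and> ?W M = m}"
        using Suc by auto
      then show ?thesis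
        using card_subsets_weight[OF n turning_points_subset, of \<sigma> m] Suc
        by (simp add: turning_number_def flip: turning_points_def)
    qed simp
    finally show "card {w \<in> carrier (oriented_group n). oriented_rising_number n w = a \<and> forget_orientation w = \<sigma>} =
        ?c a (Suc (turning_number n \<sigma>))" .
  qed (use finite_symmetric_group in auto)
  also have "class_sums (symmetric_group n) (\<lambda>\<sigma>. Suc (turning_number n \<sigma>)) =
      class_sums (symmetric_group n) (turning_number n)"
    by (simp add: class_sums_def level_sets_def)
  finally show ?thesis .
qed

text \<open>Forgetting orientations carries the span of the oriented ruffle sums to that of the
  ruffle sums, and the span of the rising number classes to that of the turning classes.\<close>

lemma span_ruffle_hand:
  assumes "1 \<le> n"
  shows "malg.span (image_class_sums (ruffle_monoid n) hand (ruffle n)) =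
    malg.span (class_sums (symmetric_group n) (turning_number n))"
  unfolding ruffle_eq_comp
  using span_image_class_sums_comp[OF span_orientedruffle_hand[OF assms]] span_forget_orientation[OF assms]
  by (rule trans)

theorem mainTheorem3:
  fixes n :: nat
  assumes "n \<ge> 1"
  shows "does_the_right_thing (ruffle_monoid n) hand (symmetric_group n) (turning_number n) (ruffle n)
    \<and> does_the_right_thing (oriented_group n) (oriented_rising_number n)
        (symmetric_group n) (turning_number n) forget_orientation
    \<and> lumping (symmetric_group n) (turning_number n)
    \<and> (\<forall>f\<in>turning_algebra n. \<forall>g\<in>turning_algebra n.
         malg_mult (symmetric_group n) f g = malg_mult (symmetric_group n) g f)"
proof (intro conjI ballI)
  have finite_levels: "finite D" if "D \<in> level_sets (symmetric_group n) (turning_number n)" for D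
    using that finite_symmetric_group[of n] by (auto simp: level_sets_def)
  show "does_the_right_thing (ruffle_monoid n) hand (symmetric_group n) (turning_number n) (ruffle n)"
    by (intro does_the_right_thingI lumping_hand finite_levels monoid_hom_ruffle span_ruffle_hand assms)
  have "lumping (oriented_group n) (oriented_rising_number n)"
    by (rule lumping_if_span_eq[OF monoid_hom_orientedruffle finite_oriented_group
          span_orientedruffle_hand[OF assms]])
  then show "does_the_right_thing (oriented_group n) (oriented_rising_number n)
      (symmetric_group n) (turning_number n) forget_orientation"
    by (intro does_the_right_thingI finite_levels monoid_hom_forget_orientation span_forget_orientation assms)
  show "lumping (symmetric_group n) (turning_number n)"
    by (rule lumping_if_span_eq[OF monoid_hom_ruffle finite_symmetric_group span_ruffle_hand[OF assms]])
  show "malg_mult (symmetric_group n) f g = malg_mult (symmetric_group n) g f"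
    if "f \<in> turning_algebra n" "g \<in> turning_algebra n" for f g
    by (rule hand_image_span_commute[OF monoid_hom_ruffle])
      (use that in \<open>simp_all add: turning_algebra_def span_ruffle_hand[OF assms]\<close>)
qed

end
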